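(* In the STAR-RIS connected-UE model below, assume $a_c>a_t\tau_c$ and put $\tau_c^*=\frac{\tau_c}{a_c-a_t\tau_c}$. Then the coverage probability $P_{c,STAR}=\mathbb P(\gamma_c>\tau_c)$ equals $$P_{c,STAR}=\sum_{\chi\in\{\mathrm T,\mathrm R\}}\int_0^\infty\pi\lambda_Br_1\sum_{m=0}^{k-1}\frac{(-1)^m}{m!}\,e^{\Lambda_\chi(1)}\,\mathcal B_m\!\big(\Lambda_\chi'(1),\dots,\Lambda_\chi^{(m)}(1)\big)\,dr_1,$$ where for fixed $r_1$ and $x>0$ $$\Lambda_\chi(x)=-s_{c,\chi}n_0^2x-\tfrac12\pi\lambda_Br_1^2F(D^c_{\mathrm T\chi}x)-\tfrac12\pi\lambda_Br_1^2F(D^c_{\mathrm R\chi}x),$$ $s_{c,\chi}=\frac{\tau_c^*(r_1d_c)^\alpha}{\theta_r\beta_\chi P_BC_r}$, $D^c_{\psi\chi}=\frac{\theta_I\tau_c^*\beta_\psi}{\theta_r\beta_\chi}$ for $\psi\in\{\mathrm T,\mathrm R\}$, and $\Lambda_\chi^{(i)}$ is the $i$-th derivative in $x$.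
   Context: STAR-RIS connected-UE model. Constants: $\lambda_B,P_B,C_r,\theta_r,\theta_I>0$, $d_c>0$ (fixed STAR-RIS–connected-UE distance), noise power $n_0^2\ge0$, $\alpha>2$, integer $k\ge1$, $\beta_{\mathrm T}\in(0,1)$, $\beta_{\mathrm R}=1-\beta_{\mathrm T}$, $0<a_t<a_c$ with $a_t+a_c=1$, threshold $\tau_c>0$. Random elements, mutually independent unless stated: $r_1$ with density $2\pi\lambda_Br e^{-\pi\lambda_Br^2}$; $\chi$ uniform on $\{\mathrm T,\mathrm R\}$ (the mode, transmission or reflection, through which the connected UE receives its serving signal); $G\sim\Gamma(k,\theta_r)$ (shape $k$, scale $\theta_r$); conditionally on $r_1$, independent Poisson point processes $\Phi^{\mathrm T},\Phi^{\mathrm R}$ on $\{y\in\mathbb R^2:\|y\|>r_1\}$, each of intensity $\lambda_B/2$, with i.i.d. exponential marks $g_y$ of mean $\theta_I$. Set $S_c=\beta_\chi P_BC_r(r_1d_c)^{-\alpha}G$, $I_c=\sum_{y\in\Phi^{\mathrm T}}\beta_{\mathrm R}P_BC_r(\|y\|d_c)^{-\alpha}g_y+\sum_{y\in\Phi^{\mathrm R}}\beta_{\mathrm T}P_BC_r(\|y\|d_c)^{-\alpha}g_y$, and $\gamma_c=\frac{a_cS_c}{a_tS_c+I_c+n_0^2}$. Let $\delta=2/\alpha$ and $F(y)={}_2F_1(1,-\delta;1-\delta;-y)=1+\int_1^\infty\frac{2yt}{t^\alpha+y}dt$ for $y\ge0$. $\mathcal B_m$ is the $m$-th complete Bell polynomial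 ($\mathcal B_0=1$). *)

theory Defs
  imports "HOL-Probability.Probability"
begin

datatype mode = T | R

definition beta :: "real \<Rightarrow> mode \<Rightarrow> real" where
  "beta bT c = (case c of T \<Rightarrow> bT | R \<Rightarrow> 1 - bT)"

definition poisson_prob :: "real \<Rightarrow> nat \<Rightarrow> real" where
  "poisson_prob mu n = mu ^ n / fact n * exp (- mu)"

text \<open>Density of the nearest-BS distance r1: 2 pi lam r exp(-pi lam r^2) on r > 0.\<close>
definition r1_density :: "real \<Rightarrow> real \<Rightarrow> real" where
  "r1_density lam r = (if r > 0 then 2 * pi * lam * r * exp (- pi * lam * r ^ 2) else 0)"

text \<open>Law of G ~ Gamma(k, theta) (shape k >= 1 integer, scale theta) = Erlang.\<close>
definition gamma_measure :: "nat \<Rightarrow> real \<Rightarrow> real measure" where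
  "gamma_measure k th = density lborel (\<lambda>x. ennreal (erlang_density (k - 1) (1 / th) x))"

text \<open>Intensity measure on marked points (y, g) in R^2 x R of a Poisson point
  process of intensity lam/2 on {y. norm y > r} with i.i.d. exponential marks of mean thI.\<close>
definition mark_intensity :: "real \<Rightarrow> real \<Rightarrow> real \<Rightarrow> ((real \<times> real) \<times> real) measure" where
  "mark_intensity lam thI r = density lborel
     (\<lambda>p. ennreal (lam / 2 * indicator {y. norm y > r} (fst p) * exponential_density (1 / thI) (snd p)))"

definition interf :: "real \<Rightarrow> real \<Rightarrow> real \<Rightarrow> ((real \<times> real) \<times> real) set \<Rightarrow> real" where
  "interf c \<alpha> dc \<Phi> = enn2real (\<integral>\<^sup>+ p. ennreal (c * (norm (fst p) * dc) powr (- \<alpha>) * snd p) \<partial>count_space \<Phi>)"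

text \<open>F(y) = 2F1(1,-delta;1-delta;-y) = 1 + int_1^inf 2 y t / (t^alpha + y) dt.\<close>
definition hypF :: "real \<Rightarrow> real \<Rightarrow> real" where
  "hypF \<alpha> y = 1 + integral {1..} (\<lambda>t. 2 * y * t / (t powr \<alpha> + y))"

text \<open>Complete Bell polynomials via the standard recurrence
  B_0 = 1, B_{n+1}(x_1..x_{n+1}) = sum_{i=0}^n C(n,i) B_{n-i}(x_1..x_{n-i}) x_{i+1}.
  The arguments are given as a sequence x with x 1, x 2, ... .\<close>
fun bell :: "nat \<Rightarrow> (nat \<Rightarrow> real) \<Rightarrow> real" where
  "bell 0 x = 1"
| "bell (Suc n) x = (\<Sum>i\<le>n. real (n choose i) * bell (n - i) x * x (Suc i))"

definition Lam :: "real \<Rightarrow> real \<Rightarrow> real \<Rightarrow> real \<Rightarrow> real \<Rightarrow> real \<Rightarrow> real \<Rightarrow> real \<Rightarrow> real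
    \<Rightarrow> real \<Rightarrow> real \<Rightarrow> mode \<Rightarrow> real \<Rightarrow> real" where
  "Lam lam PB Cr thr thI \<alpha> dc n0 bT tauS r1 c x =
     (let s = tauS * (r1 * dc) powr \<alpha> / (thr * beta bT c * PB * Cr);
          D = (\<lambda>psi. thI * tauS * beta bT psi / (thr * beta bT c))
      in - s * n0\<^sup>2 * x - 1/2 * pi * lam * r1\<^sup>2 * hypF \<alpha> (D T * x)
                        - 1/2 * pi * lam * r1\<^sup>2 * hypF \<alpha> (D R * x))"

end

theory Submission
  imports Defs
begin

text \<open>
  Given \<open>r1 = r\<close>, coverage in mode \<open>c\<close> means that the Erlang variable \<open>G / thr\<close> exceeds the load
  \<open>J = s (n0\<^sup>2 + I)\<close>, which has probability \<open>E (\<Sum>m<k. J ^ m / m! * exp (- J))\<close>. The \<open>m\<close>-th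
  summand is a derivative at \<open>x = 1\<close> of the Laplace transform \<open>E (exp (- x J)) = exp (L x)\<close>, and
  Bell polynomials express the derivatives of \<open>exp L\<close> through those of \<open>L\<close>. The latter is explicit by
  Campbell's formula, polar coordinates and the exponential law of the marks.

  As only the joint law of finitely many counts is given, all of this is done for
  discretised interferences \<open>I\<^sub>n\<close>, finite combinations of counts increasing to \<open>I\<close>, for which
  conditioning on \<open>r1\<close> is a sum over count vectors. In the limit one obtains the probability that
  \<open>G\<close> exceeds all discretised loads times \<open>x\<close>. Letting \<open>x\<close> tend to 1 from above closes the gap between
  strict and weak inequality, and letting \<open>x\<close> tend to 0 shows that \<open>I\<close> is finite almost surely.
\<close>

section \<open>Derivatives of Laplace transforms\<close>

text \<open>\<open>interf\<close> is an \<open>enn2real\<close>, so a divergent sum would be read as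
  interference 0, that is as the best possible coverage. The event of the theorem therefore has the
  intended meaning only once divergence is known to be a null event, and this has to be extracted
  from laws of counts on sets with bounded projection. The coverage computation itself does it:
  \<open>G\<close> is a real number, so exceeding all discretised loads times a single x > 0 already
  bounds them, and the probability of this, summed over both modes, tends to 1 as x tends to 0.
  Hence the free x in \<open>covered\<close> and \<open>bell_tail\<close>, although the formula only
  uses x = 1.

  What passes to the limit in n is the Bell polynomial form: each derivative of the log-Laplace
  transform converges by dominated convergence, and \<open>bell\<close> is a polynomial in them.

  Constants: the mode contributes the factor 1/2 to the density of \<open>r1\<close>. Each of the
  two processes yields \<open>hypF - 1\<close> with factor \<open>1/2 * pi * lam * r^2\<close>; the
  two terms -1 amount to exactly the exponent \<open>pi * lam * r^2\<close> of that density, so the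
  Gaussian factor is absorbed into \<open>Lam\<close>.\<close>

lemma exp_bell_has_derivative:
  fixes L :: "nat \<Rightarrow> real \<Rightarrow> real"
  assumes L: "\<And>j. (L j has_real_derivative L (Suc j) x) (at x)"
  shows "((\<lambda>x. exp (L 0 x) * bell m (\<lambda>j. L j x)) has_real_derivative
           exp (L 0 x) * bell (Suc m) (\<lambda>j. L j x)) (at x)"
proof (induction m rule: less_induct)
  case (less m)
  show ?case
  proof (cases m)
    case 0
    show ?thesis unfolding 0
      by (auto intro!: derivative_eq_intros L)
  next
    case (Suc n)
    define E where "E i x = exp (L 0 x) * bell i (\<lambda>j. L j x)" for i x
    \<comment> \<open>The recurrence of \<open>bell\<close> is Leibniz' rule for the n-th derivative
      of \<open>L 1 * exp (L 0)\<close>. Differentiating it once more splits every summand in two,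
      and Pascal's rule merges them again.\<close>
    have E_Suc: "E (Suc n) x = (\<Sum>i\<le>n. real (n choose i) * E (n - i) x * L (Suc i) x)" for n x
      by (simp add: E_def sum_distrib_left mult_ac)
    have IH: "(E i has_real_derivative E (Suc i) x) (at x)" if "i \<le> n" for i
      using less[of i] that Suc unfolding E_def by simp
    let ?D = "\<Sum>i\<le>n. real (n choose i) * (E (Suc n - i) x * L (Suc i) x + E (n - i) x * L (Suc (Suc i)) x)"
    have der: "(E (Suc n) has_real_derivative ?D) (at x)"
      unfolding E_Suc[abs_def]
      by (rule derivative_eq_intros IH L refl diff_le_self)+
         (auto intro!: sum.cong simp: Suc_diff_le algebra_simps)
    have "?D = (\<Sum>i\<le>n. real (n choose i) * (E (Suc n - i) x * L (Suc i) x)) +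
               (\<Sum>i\<le>n. real (n choose i) * (E (n - i) x * L (Suc (Suc i)) x))"
      by (simp add: sum.distrib algebra_simps)
    \<comment> \<open>The added index i = Suc n contributes nothing, as
      \<open>n choose Suc n\<close> is 0; it prepares the index shift.\<close>
    also have "(\<Sum>i\<le>n. real (n choose i) * (E (Suc n - i) x * L (Suc i) x)) =
               (\<Sum>i\<le>Suc n. real (n choose i) * (E (Suc n - i) x * L (Suc i) x))"
      by simp
    also have "\<dots> = E (Suc n) x * L (Suc 0) x +
               (\<Sum>i\<le>n. real (n choose Suc i) * (E (n - i) x * L (Suc (Suc i)) x))"
      by (subst sum.atMost_Suc_shift) simp
    also have "\<dots> + (\<Sum>i\<le>n. real (n choose i) * (E (n - i) x * L (Suc (Suc i)) x)) =
               E (Suc n) x * L (Suc 0) x +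
               (\<Sum>i\<le>n. real (Suc n choose Suc i) * (E (n - i) x * L (Suc (Suc i)) x))"
      by (simp add: sum.distrib[symmetric] algebra_simps)
    also have "\<dots> = E (Suc (Suc n)) x"
      by (simp only: E_Suc[of "Suc n"] sum.atMost_Suc_shift) (simp add: mult.assoc)
    finally show ?thesis
      using der unfolding E_def Suc by simp
  qed
qed

text \<open>Derivatives are unique, so agreement at order 0 on an open set propagates upwards. Used
  to read off the moments of \<open>J ^ m * exp (- x * J)\<close> from a closed form of the Laplace
  transform.\<close>

lemma derivative_sequence_unique:
  fixes f g :: "nat \<Rightarrow> real \<Rightarrow> real"
  assumes f: "\<And>m x. x > 0 \<Longrightarrow> (f m has_real_derivative f (Suc m) x) (at x)"
    and g: "\<And>m x. x > 0 \<Longrightarrow> (g m has_real_derivative g (Suc m) x) (at x)"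
    and eq: "\<And>x. x > 0 \<Longrightarrow> f 0 x = g 0 x" and "x > 0"
  shows "f m x = g m x"
  using \<open>x > 0\<close>
proof (induction m arbitrary: x)
  case (Suc m)
  have "(f m has_real_derivative g (Suc m) x) (at x)"
    by (rule has_field_derivative_transform_within_open[OF g, where S="{0<..}"])
       (use Suc in auto)
  then show ?case using f[OF \<open>x > 0\<close>, of m] DERIV_unique by blast
qed (rule eq)

text \<open>Bridge to the iterated \<open>deriv\<close> of the theorem. Agreement is asked for x > 0
  only, because \<open>Lam\<close> is identified with a log-Laplace transform only there.\<close>

lemma funpow_deriv_eq:
  fixes f :: "nat \<Rightarrow> real \<Rightarrow> real"
  assumes f: "\<And>m x. x > 0 \<Longrightarrow> (f m has_real_derivative f (Suc m) x) (at x)"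
    and h: "\<And>x. x > 0 \<Longrightarrow> h x = f 0 x" and "x > 0"
  shows "(deriv ^^ m) h x = f m x"
  using \<open>x > 0\<close>
proof (induction m arbitrary: x)
  case (Suc m)
  have "((deriv ^^ m) h has_real_derivative f (Suc m) x) (at x)"
    by (rule has_field_derivative_transform_within_open[OF f, where S="{0<..}"])
       (use Suc in auto)
  then show ?case by (simp add: DERIV_imp_deriv)
qed (simp add: h)

section \<open>Differentiation under the integral sign and Laplace exponents\<close>

lemma has_derivative_under_integral:
  fixes g g' :: "real \<Rightarrow> 'a \<Rightarrow> real"
  assumes "e > 0"
    and int: "\<And>y. \<bar>y - x\<bar> < e \<Longrightarrow> integrable M (g y)"
    and der: "\<And>y w. \<bar>y - x\<bar> < e \<Longrightarrow> w \<in> space M \<Longrightarrow>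
                ((\<lambda>y. g y w) has_real_derivative g' y w) (at y)"
    and bound: "\<And>y w. \<bar>y - x\<bar> < e \<Longrightarrow> w \<in> space M \<Longrightarrow> \<bar>g' y w\<bar> \<le> h w"
    and h: "integrable M h" and meas: "g' x \<in> borel_measurable M"
  shows "integrable M (g' x)"
    and "((\<lambda>y. \<integral>w. g y w \<partial>M) has_real_derivative (\<integral>w. g' x w \<partial>M)) (at x)"
proof -
  show "integrable M (g' x)"
    using h meas bound[of x] \<open>e > 0\<close> by (intro Bochner_Integration.integrable_bound[OF h]) fastforce+
  \<comment> \<open>By the mean value theorem the bound on \<open>g'\<close> over the ball makes
    \<open>h\<close> dominate all difference quotients.\<close>
  have lip: "\<bar>g y w - g x w\<bar> \<le> h w * \<bar>y - x\<bar>" if "\<bar>y - x\<bar> < e" "w \<in> space M" for y w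
  proof -
    have "norm (g y w - g x w) \<le> h w * norm (y - x)"
      by (rule field_differentiable_bound[where S="ball x e" and f'="\<lambda>y. g' y w"])
         (use that \<open>e > 0\<close> der bound in
           \<open>auto simp: dist_real_def abs_minus_commute intro: has_field_derivative_at_within\<close>)
    then show ?thesis by simp
  qed
  show "((\<lambda>y. \<integral>w. g y w \<partial>M) has_real_derivative (\<integral>w. g' x w \<partial>M)) (at x)"
    unfolding has_field_derivative_iff tendsto_at_iff_sequentially o_def
  proof (intro allI impI)
    fix X :: "nat \<Rightarrow> real"
    assume X: "\<forall>i. X i \<in> UNIV - {x}" "X \<longlonglongrightarrow> x"
    obtain N where N: "\<And>n. n \<ge> N \<Longrightarrow> \<bar>X n - x\<bar> < e"
      using LIMSEQ_D[OF X(2) \<open>e > 0\<close>] by auto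
    have ne: "X n \<noteq> x" for n using X(1) by auto
    \<comment> \<open>Early terms of X may lie outside the ball, where nothing is known; the shift
      by N drops them.\<close>
    have "(\<lambda>n. \<integral>w. (g (X (n + N)) w - g x w) / (X (n + N) - x) \<partial>M) \<longlonglongrightarrow> (\<integral>w. g' x w \<partial>M)"
    proof (rule integral_dominated_convergence[OF meas _ h])
      show "(\<lambda>w. (g (X (n + N)) w - g x w) / (X (n + N) - x)) \<in> borel_measurable M" for n
        using int[of x] int[OF N, of "n + N"] \<open>e > 0\<close>
        by (intro borel_measurable_divide borel_measurable_diff) auto
      show "AE w in M. (\<lambda>n. (g (X (n + N)) w - g x w) / (X (n + N) - x)) \<longlonglongrightarrow> g' x w"
      proof (rule AE_I2)
        fix w assume "w \<in> space M"
        then have "((\<lambda>y. (g y w - g x w) / (y - x)) \<longlongrightarrow> g' x w) (at x)"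
          using der[of x w] \<open>e > 0\<close> by (simp add: has_field_derivative_iff)
        then have "(\<lambda>n. (g (X n) w - g x w) / (X n - x)) \<longlonglongrightarrow> g' x w"
          using X unfolding tendsto_at_iff_sequentially o_def by blast
        then show "(\<lambda>n. (g (X (n + N)) w - g x w) / (X (n + N) - x)) \<longlonglongrightarrow> g' x w"
          by (rule LIMSEQ_ignore_initial_segment)
      qed
      show "AE w in M. norm ((g (X (n + N)) w - g x w) / (X (n + N) - x)) \<le> h w" for n
        using lip[OF N, of "n + N"] ne[of "n + N"]
        by (intro AE_I2) (simp add: divide_le_eq)
    qed
    also have "(\<lambda>n. \<integral>w. (g (X (n + N)) w - g x w) / (X (n + N) - x) \<partial>M) =
               (\<lambda>n. ((\<integral>w. g (X (n + N)) w \<partial>M) - (\<integral>w. g x w \<partial>M)) / (X (n + N) - x))"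
      using int[of x] int[OF N] \<open>e > 0\<close> by (intro ext) simp
    finally show "(\<lambda>n. ((\<integral>w. g (X n) w \<partial>M) - (\<integral>w. g x w \<partial>M)) / (X n - x)) \<longlonglongrightarrow> (\<integral>w. g' x w \<partial>M)"
      by (rule LIMSEQ_offset)
  qed
qed

lemma power_mult_exp_neg_le:
  fixes x y :: real
  assumes "x > 0" "y \<ge> 0"
  shows "y ^ n * exp (- x * y) \<le> fact n / x ^ n"
proof -
  have "(x * y) ^ n / fact n \<le> exp (x * y)"
    using sum_le_suminf[OF summable_exp_generic[of "x * y"], of "{n}"] assms
    by (simp add: exp_def divide_inverse mult.commute)
  then show ?thesis
    using assms by (simp add: field_simps exp_minus power_mult_distrib)
qed

lemma integrable_power_mult_exp_neg:
  fixes u :: "'a \<Rightarrow> real"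
  assumes int: "\<And>y. y > 0 \<Longrightarrow> integrable M (\<lambda>w. u w ^ j * exp (- y * u w))"
    and u [measurable]: "u \<in> borel_measurable M" "\<And>w. w \<in> space M \<Longrightarrow> u w \<ge> 0" and "x > 0"
  shows "integrable M (\<lambda>w. u w ^ Suc j * exp (- x * u w))"
    and "((\<lambda>x. \<integral>w. u w ^ j * exp (- x * u w) \<partial>M) has_real_derivative
           - (\<integral>w. u w ^ Suc j * exp (- x * u w) \<partial>M)) (at x)"
proof -
  \<comment> \<open>For y > x / 2 the factor \<open>exp (- y * u w)\<close> is at most the square of
    \<open>exp (- (x / 4) * u w)\<close>. One copy absorbs the extra power of \<open>u w\<close> at
    the cost 4 / x, the other leaves the function that is integrable by \<open>int\<close> at x /
    4.\<close>
  define h where "h w = (4 / x) * (u w ^ j * exp (- (x / 4) * u w))" for w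
  have bound: "u w ^ Suc j * exp (- y * u w) \<le> h w" if "\<bar>y - x\<bar> < x / 2" "w \<in> space M" for y w
  proof -
    have "u w ^ Suc j * exp (- y * u w) \<le> u w ^ Suc j * exp (- (x / 2) * u w)"
    proof (intro mult_left_mono)
      have "x / 2 * u w \<le> y * u w"
        using u(2)[OF that(2)] that(1) by (intro mult_right_mono) linarith+
      then show "exp (- y * u w) \<le> exp (- (x / 2) * u w)" by simp
    qed (use u(2)[OF that(2)] in auto)
    also have "\<dots> = (u w ^ 1 * exp (- (x / 4) * u w)) * (u w ^ j * exp (- (x / 4) * u w))"
      by (simp add: exp_add[symmetric])
    also have "\<dots> \<le> (fact 1 / (x / 4) ^ 1) * (u w ^ j * exp (- (x / 4) * u w))"
      using u(2)[OF that(2)] \<open>x > 0\<close> by (intro mult_right_mono power_mult_exp_neg_le) auto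
    finally show ?thesis by (simp add: h_def)
  qed
  have bound': "\<bar>- (u w ^ Suc j * exp (- y * u w))\<bar> \<le> h w" if "\<bar>y - x\<bar> < x / 2" "w \<in> space M" for y w
    using bound[OF that] u(2)[OF that(2)] by (simp add: abs_mult)
  have der: "((\<lambda>y. u w ^ j * exp (- y * u w)) has_real_derivative - (u w ^ Suc j * exp (- y * u w))) (at y)" for y w
    by (auto intro!: derivative_eq_intros)
  have int': "integrable M (\<lambda>w. u w ^ j * exp (- y * u w))" if "\<bar>y - x\<bar> < x / 2" for y
    by (rule int) (use that in linarith)
  have h: "integrable M h"
    unfolding h_def using int[of "x / 4"] \<open>x > 0\<close> by simp
  have "x / 2 > 0" using \<open>x > 0\<close> by simp
  note has_derivative_under_integral[OF this int' der bound' h]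
  then show "integrable M (\<lambda>w. u w ^ Suc j * exp (- x * u w))"
    and "((\<lambda>x. \<integral>w. u w ^ j * exp (- x * u w) \<partial>M) has_real_derivative
           - (\<integral>w. u w ^ Suc j * exp (- x * u w) \<partial>M)) (at x)"
    by auto
qed

text \<open>The Laplace exponent of a Poisson sum with Levy measure the image of \<open>M\<close> under \<open>u\<close>,
  together with its successive derivatives.\<close>

definition laplace_exponent :: "'a measure \<Rightarrow> ('a \<Rightarrow> real) \<Rightarrow> nat \<Rightarrow> real \<Rightarrow> real" where
  "laplace_exponent M u j x =
     (if j = 0 then \<integral>w. 1 - exp (- x * u w) \<partial>M else (-1) ^ Suc j * (\<integral>w. u w ^ j * exp (- x * u w) \<partial>M))"

lemma integrable_one_minus_exp:
  fixes u :: "'a \<Rightarrow> real"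
  assumes u: "integrable M u" "\<And>w. w \<in> space M \<Longrightarrow> u w \<ge> 0" and "x \<ge> 0"
  shows "integrable M (\<lambda>w. 1 - exp (- x * u w))"
proof (rule Bochner_Integration.integrable_bound[where f="\<lambda>w. x * u w"])
  show "AE w in M. norm (1 - exp (- x * u w)) \<le> norm (x * u w)"
  proof (rule AE_I2)
    fix w assume "w \<in> space M"
    then show "norm (1 - exp (- x * u w)) \<le> norm (x * u w)"
      using u(2)[of w] \<open>x \<ge> 0\<close> exp_ge_add_one_self[of "- x * u w"] by auto
  qed
qed (use u(1) in auto)

text \<open>The measure may be infinite, so \<open>exp (- x * u w)\<close> alone need not be
  integrable. The induction therefore starts at the first power, which \<open>u\<close>
  dominates.\<close>

lemma integrable_exp_power_pos:
  fixes u :: "'a \<Rightarrow> real"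
  assumes u: "integrable M u" "\<And>w. w \<in> space M \<Longrightarrow> u w \<ge> 0" and "x > 0"
  shows "integrable M (\<lambda>w. u w ^ Suc j * exp (- x * u w))"
  using \<open>x > 0\<close>
proof (induction j arbitrary: x)
  case 0
  show ?case
    by (rule Bochner_Integration.integrable_bound[OF u(1)])
       (use u 0 in \<open>auto simp: mult_left_le\<close>)
next
  case (Suc j)
  show ?case
    by (rule integrable_power_mult_exp_neg(1)[OF Suc.IH]) (use u Suc.prems in auto)
qed

lemma laplace_exponent_has_derivative:
  fixes u :: "'a \<Rightarrow> real"
  assumes u: "integrable M u" "\<And>w. w \<in> space M \<Longrightarrow> u w \<ge> 0" and "x > 0"
  shows "(laplace_exponent M u j has_real_derivative laplace_exponent M u (Suc j) x) (at x)"
proof (cases j)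
  case 0
  have "((\<lambda>y. \<integral>w. 1 - exp (- y * u w) \<partial>M) has_real_derivative (\<integral>w. u w * exp (- x * u w) \<partial>M)) (at x)"
    by (rule has_derivative_under_integral(2)[where e = x and h = u
           and g' = "\<lambda>y w. u w * exp (- y * u w)"])
       (use u \<open>x > 0\<close> in \<open>auto intro!: integrable_one_minus_exp[of M u, simplified] derivative_eq_intros
           simp: abs_mult mult_left_le abs_less_iff\<close>)
  then show ?thesis by (simp add: 0 laplace_exponent_def[abs_def])
next
  case (Suc i)
  have "((\<lambda>x. \<integral>w. u w ^ Suc i * exp (- x * u w) \<partial>M) has_real_derivative
           - (\<integral>w. u w ^ Suc (Suc i) * exp (- x * u w) \<partial>M)) (at x)"
    using u \<open>x > 0\<close> by (intro integrable_power_mult_exp_neg(2) integrable_exp_power_pos) auto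
  from DERIV_cmult[OF this, of "(-1) ^ Suc (Suc i)"] show ?thesis
    by (simp add: Suc laplace_exponent_def[abs_def])
qed

text \<open>At order 0 the inequality 1 - exp (- v) <= v gives the dominating function. At order i +
  1 one factor \<open>un n w\<close> is bounded by \<open>u w\<close> and the rest by
  \<open>fact i / x ^ i\<close>, uniformly in n.\<close>

lemma laplace_exponent_tendsto:
  fixes u :: "'a \<Rightarrow> real"
  assumes u: "integrable M u" and un: "\<And>n. un n \<in> borel_measurable M"
    and le: "\<And>n w. w \<in> space M \<Longrightarrow> 0 \<le> un n w \<and> un n w \<le> u w"
    and lim: "\<And>w. w \<in> space M \<Longrightarrow> (\<lambda>n. un n w) \<longlonglongrightarrow> u w" and "x > 0"
  shows "(\<lambda>n. laplace_exponent M (un n) j x) \<longlonglongrightarrow> laplace_exponent M u j x"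
proof (cases j)
  case 0
  have "(\<lambda>n. \<integral>w. 1 - exp (- x * un n w) \<partial>M) \<longlonglongrightarrow> (\<integral>w. 1 - exp (- x * u w) \<partial>M)"
  proof (rule integral_dominated_convergence[where w="\<lambda>w. x * u w"])
    show "AE w in M. norm (1 - exp (- x * un n w)) \<le> x * u w" for n
    proof (rule AE_I2)
      fix w assume "w \<in> space M"
      then have "x * un n w \<le> x * u w" "0 \<le> x * un n w" using le[of w n] \<open>x > 0\<close> by auto
      then show "norm (1 - exp (- x * un n w)) \<le> x * u w"
        using exp_ge_add_one_self[of "- x * un n w"] by auto
    qed
  qed (use u un lim in \<open>auto intro!: tendsto_intros\<close>)
  then show ?thesis by (simp add: 0 laplace_exponent_def)
next
  case (Suc i)
  have "(\<lambda>n. \<integral>w. un n w ^ j * exp (- x * un n w) \<partial>M) \<longlonglongrightarrow> (\<integral>w. u w ^ j * exp (- x * u w) \<partial>M)"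
  proof (rule integral_dominated_convergence[where w="\<lambda>w. fact i / x ^ i * u w"])
    show "AE w in M. norm (un n w ^ j * exp (- x * un n w)) \<le> fact i / x ^ i * u w" for n
    proof (rule AE_I2)
      fix w assume w: "w \<in> space M"
      have "un n w ^ j * exp (- x * un n w) = (un n w ^ i * exp (- x * un n w)) * un n w"
        by (simp add: Suc)
      also have "\<dots> \<le> fact i / x ^ i * u w"
        using le[OF w, of n] \<open>x > 0\<close> by (intro mult_mono power_mult_exp_neg_le) auto
      finally show "norm (un n w ^ j * exp (- x * un n w)) \<le> fact i / x ^ i * u w"
        using le[OF w, of n] by simp
    qed
  qed (use u un lim in \<open>auto intro!: tendsto_intros\<close>)
  then show ?thesis by (auto simp: Suc laplace_exponent_def intro!: tendsto_intros)
qed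

lemma bell_tendsto:
  assumes "\<And>j. ((\<lambda>n. f n j) \<longlongrightarrow> l j) F"
  shows "((\<lambda>n. bell m (f n)) \<longlongrightarrow> bell m l) F"
proof (induction m rule: less_induct)
  case (less m)
  show ?case
  proof (cases m)
    case (Suc i)
    have "((\<lambda>n. bell (i - q) (f n)) \<longlongrightarrow> bell (i - q) l) F" for q
      using Suc by (intro less) auto
    then show ?thesis
      unfolding Suc bell.simps by (intro tendsto_intros assms)
  qed simp
qed

section \<open>Erlang tails, Poisson counts and their Laplace transforms\<close>

definition erlang_tail :: "nat \<Rightarrow> real \<Rightarrow> real" where
  "erlang_tail k y = (\<Sum>m<k. y ^ m / fact m * exp (- y))"

text \<open>\<open>erlang_tail k y\<close> is the probability that a Poisson variable of mean y is
  below k, hence a number in [0, 1]. The third bound, its summand m = 0, later compares coverage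
  from below with a Laplace transform as x tends to 0.\<close>

lemma erlang_tail_bounds:
  assumes "y \<ge> 0"
  shows "0 \<le> erlang_tail k y" "erlang_tail k y \<le> 1" "k \<ge> 1 \<Longrightarrow> exp (- y) \<le> erlang_tail k y"
proof -
  show "0 \<le> erlang_tail k y"
    unfolding erlang_tail_def using assms by (intro sum_nonneg) auto
  have "(\<Sum>m<k. y ^ m / fact m) \<le> exp y"
    using sum_le_suminf[OF summable_exp_generic[of y], of "{..<k}"] assms
    by (simp add: exp_def divide_inverse mult.commute)
  then show "erlang_tail k y \<le> 1"
    unfolding erlang_tail_def sum_distrib_right[symmetric] by (simp add: exp_minus field_simps)
  assume "k \<ge> 1"
  then have "(\<Sum>m\<in>{0}. y ^ m / fact m * exp (- y)) \<le> erlang_tail k y"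
    unfolding erlang_tail_def using assms by (intro sum_mono2) auto
  then show "exp (- y) \<le> erlang_tail k y" by simp
qed

lemma emeasure_gamma_measure_tail:
  assumes "th > 0" "k \<ge> 1" "z \<ge> 0"
  shows "emeasure (gamma_measure k th) {z<..} = ennreal (erlang_tail k (z / th))"
proof -
  interpret prob_space "gamma_measure k th"
    unfolding gamma_measure_def using assms by (intro prob_space_erlang_density) auto
  have [simp]: "space (gamma_measure k th) = UNIV" "sets (gamma_measure k th) = sets borel"
    by (auto simp: gamma_measure_def)
  have le: "emeasure (gamma_measure k th) {..z} = ennreal (erlang_CDF (k - 1) (1 / th) z)"
    using assms unfolding gamma_measure_def by (intro emeasure_erlang_density) auto
  have CDF: "erlang_CDF (k - 1) (1 / th) z = 1 - erlang_tail k (z / th)"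
    \<comment> \<open>The library index is the shape minus 1 and its sum includes the upper end, so
      k >= 1 turns it into the range m < k.\<close>
    using assms by (cases k) (auto simp: erlang_CDF_def erlang_tail_def lessThan_Suc_atMost)
  have "emeasure (gamma_measure k th) {z<..} = emeasure (gamma_measure k th) (UNIV - {..z})"
    by (rule arg_cong[where f="emeasure _"]) auto
  also have "\<dots> = 1 - ennreal (1 - erlang_tail k (z / th))"
    using emeasure_space_1 by (subst emeasure_compl[where M="gamma_measure k th", simplified]) (auto simp: le CDF[simplified])
  also have "\<dots> = ennreal (erlang_tail k (z / th))"
    using erlang_tail_bounds[of "z / th" k] assms
    by (simp add: ennreal_1[symmetric] ennreal_minus del: ennreal_1)
  finally show ?thesis .
qed

text \<open>If \<open>L j\<close> is the j-th derivative of \<open>L 0\<close> and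
  \<open>exp (L 0 x)\<close> is the Laplace transform of a load J, then the m-th summand is the mean
  of \<open>(x * J) ^ m / fact m * exp (- x * J)\<close>; the sign of \<open>- x\<close> cancels the
  sign of the m-th derivative.\<close>

definition bell_tail :: "nat \<Rightarrow> (nat \<Rightarrow> real \<Rightarrow> real) \<Rightarrow> real \<Rightarrow> real" where
  "bell_tail k L x = (\<Sum>m<k. (- x) ^ m / fact m * (exp (L 0 x) * bell m (\<lambda>j. L j x)))"

lemma (in prob_space) expectation_erlang_tail:
  fixes J :: "'a \<Rightarrow> real"
  assumes J [measurable]: "J \<in> borel_measurable M" and nn: "\<And>w. w \<in> space M \<Longrightarrow> J w \<ge> 0"
    and L: "\<And>j x. x > 0 \<Longrightarrow> (L j has_real_derivative L (Suc j) x) (at x)"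
    and lap: "\<And>x. x > 0 \<Longrightarrow> expectation (\<lambda>w. exp (- x * J w)) = exp (L 0 x)"
    and "x > 0"
  shows "expectation (\<lambda>w. erlang_tail k (x * J w)) = bell_tail k L x"
proof -
  have int: "integrable M (\<lambda>w. J w ^ m * exp (- x * J w))" if "x > 0" for m x
    using that
  proof (induction m arbitrary: x)
    case 0
    show ?case by (rule integrable_const_bound[where B=1]) (use 0 nn in auto)
  next
    case (Suc m)
    show ?case
      by (rule integrable_power_mult_exp_neg(1)[OF Suc.IH]) (use nn Suc.prems in auto)
  qed
  \<comment> \<open>Both sides, as sequences in m, consist of successive derivatives in x; at m = 0
    they agree by \<open>lap\<close>.\<close>
  have "(-1) ^ m * expectation (\<lambda>w. J w ^ m * exp (- x * J w)) = exp (L 0 x) * bell m (\<lambda>j. L j x)" for m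
  proof (rule derivative_sequence_unique[where x=x and m=m
        and f = "\<lambda>m x. (-1) ^ m * expectation (\<lambda>w. J w ^ m * exp (- x * J w))"
        and g = "\<lambda>m x. exp (L 0 x) * bell m (\<lambda>j. L j x)"])
    fix m x assume x: "x > (0::real)"
    have "((\<lambda>x. expectation (\<lambda>w. J w ^ m * exp (- x * J w))) has_real_derivative
           - expectation (\<lambda>w. J w ^ Suc m * exp (- x * J w))) (at x)"
      by (rule integrable_power_mult_exp_neg(2)[OF int]) (use nn x in auto)
    from DERIV_cmult[OF this, of "(-1) ^ m"]
    show "((\<lambda>x. (-1) ^ m * expectation (\<lambda>w. J w ^ m * exp (- x * J w))) has_real_derivative
       (-1) ^ Suc m * expectation (\<lambda>w. J w ^ Suc m * exp (- x * J w))) (at x)" by simp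
    show "((\<lambda>x. exp (L 0 x) * bell m (\<lambda>j. L j x)) has_real_derivative
        exp (L 0 x) * bell (Suc m) (\<lambda>j. L j x)) (at x)"
      by (rule exp_bell_has_derivative) (rule L[OF x])
  qed (use lap \<open>x > 0\<close> in auto)
  note bell_eq = this[symmetric]
  have "expectation (\<lambda>w. erlang_tail k (x * J w)) =
        expectation (\<lambda>w. \<Sum>m<k. x ^ m / fact m * (J w ^ m * exp (- x * J w)))"
    by (simp add: erlang_tail_def power_mult_distrib mult_ac)
  also have "\<dots> = (\<Sum>m<k. x ^ m / fact m * expectation (\<lambda>w. J w ^ m * exp (- x * J w)))"
    using int[OF \<open>x > 0\<close>] by (subst Bochner_Integration.integral_sum) auto
  also have "\<dots> = bell_tail k L x"
    unfolding bell_tail_def bell_eq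
  proof (intro sum.cong refl)
    fix m
    have "(- x) ^ m * (-1) ^ m = x ^ m" by (simp flip: power_mult_distrib)
    then show "x ^ m / fact m * expectation (\<lambda>w. J w ^ m * exp (- x * J w)) =
      (- x) ^ m / fact m * ((-1) ^ m * expectation (\<lambda>w. J w ^ m * exp (- x * J w)))"
      by (simp add: field_simps)
  qed
  finally show ?thesis .
qed

text \<open>Rate 0 does occur, for null level sets (for instance when n <= r); the point mass at 0
  is then the law with weights \<open>poisson_prob 0\<close>.\<close>

definition pois :: "real \<Rightarrow> nat pmf" where
  "pois mu = (if mu > 0 then poisson_pmf mu else return_pmf 0)"

lemma pmf_pois: "mu \<ge> 0 \<Longrightarrow> pmf (pois mu) n = poisson_prob mu n"
  by (cases "mu = 0") (auto simp: pois_def poisson_prob_def power_0_left)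

lemma poisson_prob_nonneg: "mu \<ge> 0 \<Longrightarrow> poisson_prob mu n \<ge> 0"
  by (simp add: poisson_prob_def)

lemma pois_laplace:
  assumes "mu \<ge> 0"
  shows "integrable (pois mu) (\<lambda>n. exp (- t * real n))"
    and "measure_pmf.expectation (pois mu) (\<lambda>n. exp (- t * real n)) = exp (- (1 - exp (- t)) * mu)"
proof -
  have sums: "(\<lambda>n. poisson_prob mu n * exp (- t * real n)) sums exp (- (1 - exp (- t)) * mu)"
  proof -
    have "(\<lambda>n. exp (- mu) * ((mu * exp (- t)) ^ n /\<^sub>R fact n)) sums (exp (- mu) * exp (mu * exp (- t)))"
      by (intro sums_mult exp_converges)
    moreover have "exp (- mu) * ((mu * exp (- t)) ^ n /\<^sub>R fact n) = poisson_prob mu n * exp (- t * real n)" for n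
      by (simp add: poisson_prob_def power_mult_distrib exp_of_nat_mult[symmetric] field_simps)
    ultimately show ?thesis by (simp add: exp_add[symmetric] algebra_simps)
  qed
  have "(\<integral>\<^sup>+ n. ennreal (exp (- t * real n)) \<partial>pois mu) =
        (\<Sum>n. ennreal (poisson_prob mu n * exp (- t * real n)))"
    using assms by (simp add: nn_integral_measure_pmf pmf_pois nn_integral_count_space_nat
        ennreal_mult poisson_prob_nonneg)
  also have "\<dots> = ennreal (exp (- (1 - exp (- t)) * mu))"
    using sums assms by (subst suminf_ennreal2)
      (auto simp: sums_iff poisson_prob_nonneg)
  finally have nn: "(\<integral>\<^sup>+ n. ennreal (exp (- t * real n)) \<partial>pois mu) = ennreal (exp (- (1 - exp (- t)) * mu))" .
  then have "has_bochner_integral (pois mu) (\<lambda>n. exp (- t * real n)) (exp (- (1 - exp (- t)) * mu))"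
    by (intro has_bochner_integral_nn_integral) auto
  then show "integrable (pois mu) (\<lambda>n. exp (- t * real n))"
    "measure_pmf.expectation (pois mu) (\<lambda>n. exp (- t * real n)) = exp (- (1 - exp (- t)) * mu)"
    by (auto simp: has_bochner_integral_iff)
qed

text \<open>Independence factorises the transform into Poisson transforms: a finite form of
  Campbell's formula, with \<open>b\<close> in the role of the deterministic noise.\<close>

lemma Pi_pois_laplace:
  assumes "finite I" "\<And>i. i \<in> I \<Longrightarrow> mu i \<ge> 0"
  shows "measure_pmf.expectation (Pi_pmf I 0 (\<lambda>i. pois (mu i)))
           (\<lambda>v. exp (- x * (b + (\<Sum>i\<in>I. w i * real (v i))))) =
         exp (- x * b - (\<Sum>i\<in>I. (1 - exp (- x * w i)) * mu i))"
proof -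
  have "exp (- x * (b + (\<Sum>i\<in>I. w i * real (v i)))) =
        exp (- x * b) * (\<Prod>i\<in>I. exp (- (x * w i) * real (v i)))" for v
    using assms(1) by (simp add: exp_sum[symmetric] exp_add[symmetric] sum_negf sum_distrib_left algebra_simps)
  then have "measure_pmf.expectation (Pi_pmf I 0 (\<lambda>i. pois (mu i)))
           (\<lambda>v. exp (- x * (b + (\<Sum>i\<in>I. w i * real (v i))))) =
         exp (- x * b) * measure_pmf.expectation (Pi_pmf I 0 (\<lambda>i. pois (mu i)))
           (\<lambda>v. \<Prod>i\<in>I. exp (- (x * w i) * real (v i)))"
    by simp
  also have "measure_pmf.expectation (Pi_pmf I 0 (\<lambda>i. pois (mu i)))
           (\<lambda>v. \<Prod>i\<in>I. exp (- (x * w i) * real (v i))) =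
        (\<Prod>i\<in>I. measure_pmf.expectation (pois (mu i)) (\<lambda>n. exp (- (x * w i) * real n)))"
    using assms by (intro expectation_prod_Pi_pmf pois_laplace) auto
  also have "\<dots> = (\<Prod>i\<in>I. exp (- (1 - exp (- (x * w i))) * mu i))"
    using assms by (intro prod.cong refl pois_laplace) auto
  also have "\<dots> = exp (- (\<Sum>i\<in>I. (1 - exp (- x * w i)) * mu i))"
    using assms(1) by (simp add: exp_sum[symmetric] sum_negf[symmetric] algebra_simps)
  finally show ?thesis by (simp add: exp_add[symmetric])
qed

section \<open>The Laplace exponent of the marked point process\<close>

lemma borel_measurable_fst_snd [measurable]:
  fixes f :: "_ \<Rightarrow> 'a :: second_countable_topology \<times> 'b :: second_countable_topology"
  assumes "f \<in> M \<rightarrow>\<^sub>M borel"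
  shows "(\<lambda>x. fst (f x)) \<in> M \<rightarrow>\<^sub>M borel" "(\<lambda>x. snd (f x)) \<in> M \<rightarrow>\<^sub>M borel"
  using assms by (auto simp flip: borel_prod)

text \<open>Negating the norm makes the sets \<open>{x<..}\<close> pull back to bounded balls, so that
  the two measures only have to be compared on half-lines of finite measure.\<close>

lemma nn_integral_polar:
  fixes h :: "real \<Rightarrow> ennreal"
  assumes [measurable]: "h \<in> borel_measurable borel"
  shows "(\<integral>\<^sup>+ y. h (norm (y :: real \<times> real)) \<partial>lborel) = (\<integral>\<^sup>+ t. ennreal (2 * pi * t) * h t \<partial>lborel)"
proof -
  define M1 where "M1 = distr lborel borel (\<lambda>y :: real \<times> real. - norm y)"
  define M2 where "M2 = density lborel (\<lambda>t. ennreal (- 2 * pi * t))"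
  have M1: "emeasure M1 {x<..} = (if x < 0 then ennreal (pi * x\<^sup>2) else 0)" for x
  proof -
    have "emeasure M1 {x<..} = emeasure lborel (ball (0 :: real \<times> real) (- x))"
      unfolding M1_def by (subst emeasure_distr) (auto intro!: arg_cong[where f="emeasure _"])
    also have "\<dots> = (if x < 0 then ennreal (pi * x\<^sup>2) else 0)"
      using emeasure_ball[of "- x" "0 :: real \<times> real"]
      by (auto simp: unit_ball_vol_2 power2_eq_square not_less ball_empty)
    finally show ?thesis .
  qed
  have M2: "emeasure M2 {x<..} = (if x < 0 then ennreal (pi * x\<^sup>2) else 0)" for x
  proof (cases "x < 0")
    case True
    have "emeasure M2 {x<..} = (\<integral>\<^sup>+ t. ennreal (- 2 * pi * t) * indicator {x<..} t \<partial>lborel)"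
      unfolding M2_def by (subst emeasure_density) auto
    \<comment> \<open>For t > 0 the density is \<open>ennreal\<close> of a negative number, hence 0,
      and the added endpoint x is null; the compact interval suits the fundamental theorem of
      calculus.\<close>
    also have "\<dots> = (\<integral>\<^sup>+ t. ennreal (- 2 * pi * t) * indicator {x..0} t \<partial>lborel)"
      using AE_lborel_singleton[of x]
      by (intro nn_integral_cong_AE) (auto elim!: eventually_mono split: split_indicator
          simp: ennreal_eq_0_iff mult_nonneg_nonneg)
    also have "\<dots> = ennreal (- pi * 0\<^sup>2 - (- pi * x\<^sup>2))"
      using True
      by (intro nn_integral_FTC_Icc[where F="\<lambda>t. - pi * t\<^sup>2"])
         (auto intro!: derivative_eq_intros simp: mult_nonneg_nonpos)
    finally show ?thesis using True by simp
  next
    case False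
    then show ?thesis unfolding M2_def
      by (subst emeasure_density)
         (auto intro!: nn_integral_zero' simp: ennreal_neg split: split_indicator)
  qed
  have "M1 = M2"
    by (rule measure_eqI_lessThan) (auto simp: M1 M2 M1_def[THEN arg_cong[where f=sets]]
        M2_def[THEN arg_cong[where f=sets]])
  have "(\<integral>\<^sup>+ y. h (norm (y :: real \<times> real)) \<partial>lborel) = (\<integral>\<^sup>+ t. h (- t) \<partial>M1)"
    unfolding M1_def by (subst nn_integral_distr) auto
  also have "\<dots> = (\<integral>\<^sup>+ t. ennreal (- 2 * pi * t) * h (- t) \<partial>lborel)"
    unfolding \<open>M1 = M2\<close> M2_def by (subst nn_integral_density) auto
  also have "\<dots> = (\<integral>\<^sup>+ t. ennreal (2 * pi * t) * h t \<partial>lborel)"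
    by (subst nn_integral_real_affine[where c="-1" and t=0]) auto
  finally show ?thesis .
qed

lemma nn_integral_mark_intensity:
  fixes \<phi> :: "real \<Rightarrow> real \<Rightarrow> ennreal"
  assumes [measurable]: "(\<lambda>(a, b). \<phi> a b) \<in> borel_measurable (borel \<Otimes>\<^sub>M borel)"
    and "lam > 0" "thI > 0"
  shows "(\<integral>\<^sup>+ p. \<phi> (norm (fst p)) (snd p) \<partial>mark_intensity lam thI r) =
    (\<integral>\<^sup>+ t. ennreal (pi * lam * t) * indicator {r<..} t *
       (\<integral>\<^sup>+ g. ennreal (exponential_density (1 / thI) g) * \<phi> t g \<partial>lborel) \<partial>lborel)"
proof -
  let ?e = "exponential_density (1 / thI)"
  have "(\<integral>\<^sup>+ p. \<phi> (norm (fst p)) (snd p) \<partial>mark_intensity lam thI r) =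
    (\<integral>\<^sup>+ p. ennreal (lam / 2) * indicator {r<..} (norm (fst p)) * ennreal (?e (snd p)) *
       \<phi> (norm (fst p)) (snd p) \<partial>((lborel :: (real \<times> real) measure) \<Otimes>\<^sub>M lborel))"
  proof -
    have "(\<lambda>p :: (real \<times> real) \<times> real. (norm (fst p), snd p)) \<in> borel \<rightarrow>\<^sub>M borel \<Otimes>\<^sub>M borel"
      by measurable
    from measurable_compose[OF this assms(1)]
    have "(\<lambda>p :: (real \<times> real) \<times> real. \<phi> (norm (fst p)) (snd p)) \<in> borel_measurable lborel"
      by simp
    then show ?thesis
      unfolding mark_intensity_def lborel_prod using assms(2,3)
      by (subst nn_integral_density)
         (auto intro!: nn_integral_cong simp: ennreal_mult[symmetric] exponential_density_nonneg
            split: split_indicator)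
  qed
  also have "\<dots> = (\<integral>\<^sup>+ y. \<integral>\<^sup>+ g. ennreal (lam / 2) * indicator {r<..} (norm (y :: real \<times> real)) * ennreal (?e g) *
       \<phi> (norm y) g \<partial>lborel \<partial>lborel)"
    by (subst lborel.nn_integral_fst[symmetric]) auto
  also have "\<dots> = (\<integral>\<^sup>+ y. ennreal (lam / 2) * indicator {r<..} (norm (y :: real \<times> real)) *
      (\<integral>\<^sup>+ g. ennreal (?e g) * \<phi> (norm y) g \<partial>lborel) \<partial>lborel)"
    by (intro nn_integral_cong) (simp add: mult.assoc nn_integral_cmult)
  also have "\<dots> = (\<integral>\<^sup>+ t. ennreal (2 * pi * t) * (ennreal (lam / 2) * indicator {r<..} t *
      (\<integral>\<^sup>+ g. ennreal (?e g) * \<phi> t g \<partial>lborel)) \<partial>lborel)"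
    by (intro nn_integral_polar) measurable
  also have "\<dots> = (\<integral>\<^sup>+ t. ennreal (pi * lam * t) * indicator {r<..} t *
       (\<integral>\<^sup>+ g. ennreal (?e g) * \<phi> t g \<partial>lborel) \<partial>lborel)"
  proof (intro nn_integral_cong)
    fix t :: real
    have "ennreal (2 * pi * t) * ennreal (lam / 2) = ennreal (pi * lam * t)"
      using assms(2) ennreal_mult''[of "lam / 2" "2 * pi * t"] by (simp add: mult.commute mult.left_commute)
    then show "ennreal (2 * pi * t) * (ennreal (lam / 2) * indicator {r<..} t *
        (\<integral>\<^sup>+ g. ennreal (?e g) * \<phi> t g \<partial>lborel)) =
      ennreal (pi * lam * t) * indicator {r<..} t * (\<integral>\<^sup>+ g. ennreal (?e g) * \<phi> t g \<partial>lborel)"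
      by (simp add: mult.assoc[symmetric])
  qed
  finally show ?thesis .
qed

text \<open>Exponential tilting: \<open>exp (- t * g)\<close> times the density of rate 1 / th is 1
  / (1 + t * th) times the density of rate t + 1 / th, so only total masses of probability densities
  are integrated. The \<open>max 0\<close> keeps the integrand nonnegative also where the density
  vanishes.\<close>

lemma nn_integral_exponential_one_minus_exp:
  assumes "th > 0" "t \<ge> 0"
  shows "(\<integral>\<^sup>+ g. ennreal (exponential_density (1 / th) g) * ennreal (1 - exp (- t * max 0 g)) \<partial>lborel) =
         ennreal (t * th / (1 + t * th))"
proof -
  have one: "has_bochner_integral lborel (exponential_density l) 1" if "l > 0" for l
  proof (rule has_bochner_integral_nn_integral)
    show "(\<integral>\<^sup>+ x. ennreal (exponential_density l x) \<partial>lborel) = ennreal 1"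
      using prob_space.emeasure_space_1[OF prob_space_exponential_density[OF that]]
      by (simp add: emeasure_density)
  qed (use that in \<open>auto simp: exponential_density_def\<close>)
  have pos: "t + 1 / th > 0" using assms by (simp add: add_nonneg_pos)
  have "has_bochner_integral lborel (\<lambda>g. exponential_density (1 / th) g -
          1 / (1 + t * th) * exponential_density (t + 1 / th) g) (1 - 1 / (1 + t * th) * 1)"
    using assms pos by (intro has_bochner_integral_diff has_bochner_integral_mult_right one) auto
  moreover have "exponential_density (1 / th) g - 1 / (1 + t * th) * exponential_density (t + 1 / th) g =
    exponential_density (1 / th) g * (1 - exp (- t * max 0 g))" for g
  proof (cases "g < 0")
    case False
    have "1 + t * th > 0" using assms by (simp add: add_pos_nonneg)
    moreover have "(t + 1 / th) = (1 + t * th) / th" using assms by (simp add: field_simps)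
    moreover have "exp (- g * ((1 + t * th) / th)) = exp (- g / th) * exp (- t * g)"
      using assms by (simp add: exp_add[symmetric] field_simps)
    ultimately have "1 / (1 + t * th) * ((t + 1 / th) * exp (- g * (t + 1 / th))) =
        1 / th * exp (- g / th) * exp (- t * g)"
      by (simp only:) simp
    moreover have "exponential_density (1 / th) g = 1 / th * exp (- g / th)"
        "exponential_density (t + 1 / th) g = (t + 1 / th) * exp (- g * (t + 1 / th))" "max 0 g = g"
      using False by (simp_all add: exponential_density_def)
    ultimately show ?thesis by (simp only:) (simp add: diff_divide_distrib right_diff_distrib)
  qed (simp add: exponential_density_def)
  moreover have "1 - 1 / (1 + t * th) * 1 = t * th / (1 + t * th)"
    using assms by (simp add: field_simps add_nonneg_eq_0_iff)
  ultimately have "has_bochner_integral lborel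
      (\<lambda>g. exponential_density (1 / th) g * (1 - exp (- t * max 0 g))) (t * th / (1 + t * th))"
    by simp
  then have "(\<integral>\<^sup>+ g. ennreal (exponential_density (1 / th) g * (1 - exp (- t * max 0 g))) \<partial>lborel) =
         ennreal (t * th / (1 + t * th))"
    using assms by (subst nn_integral_eq_integral)
      (auto simp: has_bochner_integral_iff exponential_density_nonneg)
  then show ?thesis
    using assms by (simp add: ennreal_mult exponential_density_nonneg)
qed

lemma nn_integral_powr_to_inf:
  assumes "e < -1" "a > 0" "c \<ge> 0"
  shows "(\<integral>\<^sup>+ t. ennreal (c * t powr e) * indicator {a..} t \<partial>lborel) < \<infinity>"
proof -
  have "((\<lambda>t. c * t powr e) has_integral c * (-(a powr (e+1)) / (e+1))) {a..}"
    by (intro has_integral_mult_right has_integral_powr_to_inf assms)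
  from nn_integral_has_integral_lebesgue'[OF _ this] show ?thesis
    using assms by (simp add: less_top)
qed

text \<open>\<open>interf\<close> puts the raw mark under \<open>ennreal\<close>, which truncates
  negative terms to 0. The \<open>max 0\<close> performs the same truncation on real numbers, so the
  results on Laplace exponents of nonnegative functions apply.\<close>

definition path_gain :: "real \<Rightarrow> real \<Rightarrow> (real \<times> real) \<times> real \<Rightarrow> real" where
  "path_gain \<alpha> dc p = (norm (fst p) * dc) powr (- \<alpha>) * max 0 (snd p)"

lemma path_gain_nonneg: "path_gain \<alpha> dc p \<ge> 0"
  by (simp add: path_gain_def)

lemma path_gain_measurable [measurable]: "path_gain \<alpha> dc \<in> borel_measurable borel"
  unfolding path_gain_def[abs_def]
  by measurable

lemma space_sets_mark_intensity [simp, measurable_cong]: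
  "space (mark_intensity lam thI r) = UNIV" "sets (mark_intensity lam thI r) = sets borel"
  by (simp_all add: mark_intensity_def)

text \<open>In polar coordinates the integrand is a multiple of
  \<open>t powr (1 - \<alpha>)\<close>: integrable at infinity because \<open>\<alpha>\<close> > 2,
  and kept away from the singularity at 0 by the excluded ball of radius r > 0.\<close>

lemma integrable_path_gain:
  assumes "lam > 0" "thI > 0" "\<alpha> > 2" "dc > 0" "r > 0"
  shows "integrable (mark_intensity lam thI r) (path_gain \<alpha> dc)"
proof (rule integrableI_bounded)
  show "path_gain \<alpha> dc \<in> borel_measurable (mark_intensity lam thI r)" by measurable
  have mean: "(\<integral>\<^sup>+ g. ennreal (exponential_density (1 / thI) g) * ennreal (a * max 0 g) \<partial>lborel) = ennreal (a * thI)"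
    if "a \<ge> 0" for a
  proof -
    have "(\<integral>\<^sup>+ g. ennreal (exponential_density (1 / thI) g) * ennreal (a * max 0 g) \<partial>lborel) =
          (\<integral>\<^sup>+ g. ennreal a * ennreal (exponential_density (1 / thI) g * g ^ 1) \<partial>lborel)"
      using that assms by (intro nn_integral_cong)
        (auto simp: ennreal_mult[symmetric] exponential_density_def max_def mult_ac)
    also have "\<dots> = ennreal a * (\<integral>\<^sup>+ g. ennreal (exponential_density (1 / thI) g * g ^ 1) \<partial>lborel)"
      by (intro nn_integral_cmult) auto
    also have "\<dots> = ennreal (a * thI)"
      using assms that by (subst nn_integral_erlang_ith_moment) (auto simp: ennreal_mult)
    finally show ?thesis .
  qed
  have "(\<integral>\<^sup>+ p. ennreal (norm (path_gain \<alpha> dc p)) \<partial>mark_intensity lam thI r) =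
     (\<integral>\<^sup>+ p. ennreal ((norm (fst p) * dc) powr (- \<alpha>) * max 0 (snd p)) \<partial>mark_intensity lam thI r)"
    by (simp add: path_gain_nonneg) (simp add: path_gain_def)
  also have "\<dots> = (\<integral>\<^sup>+ t. ennreal (pi * lam * t) * indicator {r<..} t *
       (\<integral>\<^sup>+ g. ennreal (exponential_density (1 / thI) g) * ennreal ((t * dc) powr (- \<alpha>) * max 0 g) \<partial>lborel) \<partial>lborel)"
    using assms by (intro nn_integral_mark_intensity[where \<phi>="\<lambda>t g. ennreal ((t * dc) powr (- \<alpha>) * max 0 g)"]) auto
  also have "\<dots> = (\<integral>\<^sup>+ t. ennreal (pi * lam * t) * indicator {r<..} t * ennreal ((t * dc) powr (- \<alpha>) * thI) \<partial>lborel)"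
    by (simp add: mean)
  also have "\<dots> \<le> (\<integral>\<^sup>+ t. ennreal ((pi * lam * thI * dc powr (- \<alpha>)) * t powr (1 - \<alpha>)) * indicator {r..} t \<partial>lborel)"
  proof (intro nn_integral_mono)
    fix t :: real
    show "ennreal (pi * lam * t) * indicator {r<..} t * ennreal ((t * dc) powr (- \<alpha>) * thI) \<le>
      ennreal ((pi * lam * thI * dc powr (- \<alpha>)) * t powr (1 - \<alpha>)) * indicator {r..} t"
    proof (cases "t > r")
      case True
      then have "t > 0" using assms by simp
      then have "t powr (1 - \<alpha>) = t * t powr (- \<alpha>)" using powr_add[of t 1 "- \<alpha>"] by simp
      then have "ennreal (pi * lam * t) * ennreal ((t * dc) powr (- \<alpha>) * thI) =
        ennreal ((pi * lam * thI * dc powr (- \<alpha>)) * t powr (1 - \<alpha>))"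
        using \<open>t > 0\<close> assms by (subst ennreal_mult[symmetric]) (auto simp: powr_mult mult_ac)
      then show ?thesis using True by simp
    qed simp
  qed
  also have "\<dots> < \<infinity>" using assms by (intro nn_integral_powr_to_inf) auto
  finally show "(\<integral>\<^sup>+ p. ennreal (norm (path_gain \<alpha> dc p)) \<partial>mark_intensity lam thI r) < \<infinity>" .
qed

text \<open>\<open>hypF\<close> is defined by a Henstock-Kurzweil integral. Equating it with the
  Lebesgue integral needs finiteness, which the majorant
  \<open>2 * y * t powr (1 - \<alpha>)\<close> supplies.\<close>

lemma nn_integral_hypF:
  assumes "\<alpha> > 2" "y \<ge> 0"
  shows "(\<integral>\<^sup>+ t. ennreal (2 * y * t / (t powr \<alpha> + y)) * indicator {1..} t \<partial>lborel) = ennreal (hypF \<alpha> y - 1)"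
proof -
  have "(\<integral>\<^sup>+ t. ennreal (2 * y * t / (t powr \<alpha> + y)) * indicator {1..} t \<partial>lborel) \<le>
        (\<integral>\<^sup>+ t. ennreal (2 * y * t powr (1 - \<alpha>)) * indicator {1..} t \<partial>lborel)"
  proof (intro nn_integral_mono)
    fix t :: real
    show "ennreal (2 * y * t / (t powr \<alpha> + y)) * indicator {1..} t \<le>
      ennreal (2 * y * t powr (1 - \<alpha>)) * indicator {1..} t"
    proof (cases "t \<ge> 1")
      case True
      have "2 * y * t / (t powr \<alpha> + y) \<le> 2 * y * t / t powr \<alpha>"
        using True assms by (intro divide_left_mono) (auto simp: add_pos_nonneg)
      also have "\<dots> = 2 * y * t powr (1 - \<alpha>)"
        using True by (simp add: powr_diff)
      finally show ?thesis using True by (simp add: ennreal_leI)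
    qed simp
  qed
  also have "\<dots> < \<infinity>" using assms by (intro nn_integral_powr_to_inf) auto
  finally have "(\<integral>\<^sup>+ t. ennreal (2 * y * t / (t powr \<alpha> + y)) * indicator {1..} t \<partial>lborel) =
      ennreal (integral {1..} (\<lambda>t. 2 * y * t / (t powr \<alpha> + y)))"
    using assms by (intro set_nn_integral_lborel_eq_integral) (auto simp: set_borel_measurable_def)
  then show ?thesis by (simp add: hypF_def)
qed

text \<open>Averaging over the mark turns 1 - exp into z / (1 + z). Measuring distances in units of
  r gives z = \<open>y / t powr \<alpha>\<close> on t > 1, and z / (1 + z) times t is half the
  integrand of \<open>hypF\<close>.\<close>

lemma laplace_exponent_path_gain:
  assumes "lam > 0" "thI > 0" "\<alpha> > 2" "dc > 0" "r > 0" "q \<ge> 0" "x \<ge> 0"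
  shows "(\<integral>p. 1 - exp (- x * (q * path_gain \<alpha> dc p)) \<partial>mark_intensity lam thI r) =
         1 / 2 * pi * lam * r\<^sup>2 * (hypF \<alpha> (x * q * thI * (r * dc) powr (- \<alpha>)) - 1)"
proof -
  define y where "y = x * q * thI * (r * dc) powr (- \<alpha>)"
  have y: "y \<ge> 0" using assms by (simp add: y_def)
  have hypF: "hypF \<alpha> y - 1 \<ge> 0"
  proof (cases "(\<lambda>t. 2 * y * t / (t powr \<alpha> + y)) integrable_on {1..}")
    case True
    then show ?thesis unfolding hypF_def using y
      by (auto intro!: Henstock_Kurzweil_Integration.integral_nonneg)
  qed (simp add: hypF_def not_integrable_integral)
  have "(\<integral>\<^sup>+ p. ennreal (1 - exp (- x * (q * path_gain \<alpha> dc p))) \<partial>mark_intensity lam thI r) =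
    (\<integral>\<^sup>+ p. ennreal (1 - exp (- (x * q * (norm (fst p) * dc) powr (- \<alpha>)) * max 0 (snd p))) \<partial>mark_intensity lam thI r)"
    by (simp add: path_gain_def mult_ac)
  also have "\<dots> = (\<integral>\<^sup>+ t. ennreal (pi * lam * t) * indicator {r<..} t *
       (\<integral>\<^sup>+ g. ennreal (exponential_density (1 / thI) g) *
          ennreal (1 - exp (- (x * q * (t * dc) powr (- \<alpha>)) * max 0 g)) \<partial>lborel) \<partial>lborel)"
    using assms by (intro nn_integral_mark_intensity[where
        \<phi>="\<lambda>t g. ennreal (1 - exp (- (x * q * (t * dc) powr (- \<alpha>)) * max 0 g))"]) auto
  also have "\<dots> = (\<integral>\<^sup>+ t. ennreal (pi * lam * t) * indicator {r<..} t *
       ennreal ((x * q * (t * dc) powr (- \<alpha>)) * thI / (1 + (x * q * (t * dc) powr (- \<alpha>)) * thI)) \<partial>lborel)"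
    using assms by (subst nn_integral_exponential_one_minus_exp) auto
  also have "\<dots> = ennreal \<bar>r\<bar> * (\<integral>\<^sup>+ t. ennreal (pi * lam * (0 + r * t)) * indicator {r<..} (0 + r * t) *
       ennreal ((x * q * ((0 + r * t) * dc) powr (- \<alpha>)) * thI / (1 + (x * q * ((0 + r * t) * dc) powr (- \<alpha>)) * thI)) \<partial>lborel)"
    using assms by (intro nn_integral_real_affine) auto
  also have "\<dots> = ennreal r * (\<integral>\<^sup>+ t. ennreal (1 / 2 * pi * lam * r) *
      (ennreal (2 * y * t / (t powr \<alpha> + y)) * indicator {1..} t) \<partial>lborel)"
  proof -
    \<comment> \<open>The point t = 1 is left out: the process lives strictly beyond r, while the
      integral in \<open>hypF\<close> includes its endpoint.\<close>
    have "ennreal (pi * lam * (0 + r * t)) * indicator {r<..} (0 + r * t) *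
       ennreal ((x * q * ((0 + r * t) * dc) powr (- \<alpha>)) * thI / (1 + (x * q * ((0 + r * t) * dc) powr (- \<alpha>)) * thI)) =
       ennreal (1 / 2 * pi * lam * r) * (ennreal (2 * y * t / (t powr \<alpha> + y)) * indicator {1..} t)"
      if "t \<noteq> 1" for t
    proof (cases "t > 1")
      case True
      have "(r * t * dc) powr (- \<alpha>) = (r * dc) powr (- \<alpha>) / t powr \<alpha>"
        using True assms powr_mult[of "r * dc" t "- \<alpha>"] by (simp add: powr_minus_divide mult_ac)
      then have z: "x * q * (r * t * dc) powr (- \<alpha>) * thI = y / t powr \<alpha>"
        by (simp add: y_def mult_ac)
      have "t powr \<alpha> > 0" using True by simp
      then have "y / t powr \<alpha> / (1 + y / t powr \<alpha>) = y / (t powr \<alpha> + y)"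
        using y by (simp add: field_simps)
      then have "ennreal (pi * lam * (r * t)) * ennreal (y / t powr \<alpha> / (1 + y / t powr \<alpha>)) =
        ennreal (1 / 2 * pi * lam * r) * ennreal (2 * y * t / (t powr \<alpha> + y))"
        using True assms y by (subst (1 2) ennreal_mult[symmetric]) (auto simp: mult_ac)
      then show ?thesis using True assms by (simp add: z)
    qed (use that assms in \<open>auto split: split_indicator\<close>)
    then show ?thesis
      using AE_lborel_singleton[of "1::real"] assms
      by (intro arg_cong2[where f="(*)"] nn_integral_cong_AE) auto
  qed
  also have "\<dots> = ennreal r * (ennreal (1 / 2 * pi * lam * r) * ennreal (hypF \<alpha> y - 1))"
    using assms y by (simp add: nn_integral_cmult nn_integral_hypF)
  also have "\<dots> = ennreal (1 / 2 * pi * lam * r\<^sup>2 * (hypF \<alpha> y - 1))"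
    using assms hypF by (simp add: ennreal_mult[symmetric] power2_eq_square mult_ac)
  finally have "(\<integral>\<^sup>+ p. ennreal (1 - exp (- x * (q * path_gain \<alpha> dc p))) \<partial>mark_intensity lam thI r) =
    ennreal (1 / 2 * pi * lam * r\<^sup>2 * (hypF \<alpha> y - 1))" .
  then show ?thesis
    using assms hypF unfolding y_def[symmetric]
    by (subst integral_eq_nn_integral) (auto simp: path_gain_nonneg)
qed

section \<open>Dyadic discretisation of a function of the marked point\<close>

type_synonym mark = "(real \<times> real) \<times> real"

text \<open>The restriction to radius n makes the projection bounded, so that counts are finite and
  their law is given; the cap at n leaves finitely many dyadic levels.\<close>

definition level_set :: "(mark \<Rightarrow> real) \<Rightarrow> nat \<Rightarrow> nat \<Rightarrow> mark set" where
  "level_set f n i = {p. norm (fst p) \<le> real n \<and> \<lfloor>min (real n) (f p) * 2 ^ n\<rfloor> = int i}"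

text \<open>The capped value n is attained, so the levels run from 0 to \<open>n * 2 ^ n\<close>
  inclusive.\<close>

definition levels :: "nat \<Rightarrow> nat" where "levels n = Suc (n * 2 ^ n)"

definition step :: "(mark \<Rightarrow> real) \<Rightarrow> nat \<Rightarrow> mark \<Rightarrow> real" where
  "step f n p = (\<Sum>i<levels n. real i / 2 ^ n * indicator (level_set f n i) p)"

lemma level_set_sets:
  assumes [measurable]: "f \<in> borel_measurable borel"
  shows "level_set f n i \<in> sets borel"
proof -
  have "{p \<in> space borel. norm (fst p) \<le> real n \<and> \<lfloor>min (real n) (f p) * 2 ^ n\<rfloor> = int i} \<in> sets borel"
    by measurable
  then show ?thesis by (simp add: level_set_def)
qed

lemma level_set_bounded: "bounded (fst ` level_set f n i)"
  by (rule bounded_subset[OF bounded_cball[of 0 "real n"]]) (auto simp: level_set_def)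

lemma level_set_disjoint: "disjoint_family_on (level_set f n) I"
  by (auto simp: disjoint_family_on_def level_set_def)

text \<open>A point within radius n lies in exactly one level set, so one summand survives. A point
  outside lies in none, and the empty sum is \<open>h 0\<close>. Besides the identity, this serves h
  = 1 - exp.\<close>

lemma comp_step_eq:
  fixes h :: "real \<Rightarrow> real"
  assumes "h 0 = 0" "f p \<ge> 0"
  shows "(\<Sum>i<levels n. h (real i / 2 ^ n) * indicator (level_set f n i) p) =
         h (if norm (fst p) \<le> real n then real_of_int \<lfloor>min (real n) (f p) * 2 ^ n\<rfloor> / 2 ^ n else 0)"
proof (cases "norm (fst p) \<le> real n")
  case True
  define z where "z = \<lfloor>min (real n) (f p) * 2 ^ n\<rfloor>"
  have z0: "z \<ge> 0" using assms by (simp add: z_def)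
  have "min (real n) (f p) * 2 ^ n \<le> real n * 2 ^ n" by (intro mult_right_mono) auto
  also have "\<dots> = of_int (int (n * 2 ^ n))" by simp
  finally have "z \<le> int (n * 2 ^ n)" unfolding z_def by linarith
  then have z: "nat z < levels n" using z0 unfolding levels_def by linarith
  have ind: "indicator (level_set f n i) p = (if i = nat z then 1 else 0 :: real)" for i
    using True z0 by (auto simp: level_set_def z_def)
  show ?thesis using z z0 True
    by (simp add: ind if_distrib[where f="\<lambda>x. _ * x"] sum.delta z_def[symmetric] cong: if_cong)
qed (auto simp: level_set_def assms)

lemma step_eq:
  assumes "f p \<ge> 0"
  shows "step f n p = (if norm (fst p) \<le> real n then real_of_int \<lfloor>min (real n) (f p) * 2 ^ n\<rfloor> / 2 ^ n else 0)"
  unfolding step_def using comp_step_eq[of "\<lambda>x. x" f p n] assms by simp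

lemma comp_step:
  fixes h :: "real \<Rightarrow> real"
  assumes "h 0 = 0" "f p \<ge> 0"
  shows "h (step f n p) = (\<Sum>i<levels n. h (real i / 2 ^ n) * indicator (level_set f n i) p)"
  using assms by (simp only: comp_step_eq step_eq)

lemma step_measurable:
  assumes "f \<in> borel_measurable borel"
  shows "step f n \<in> borel_measurable borel"
  unfolding step_def[abs_def] using level_set_sets[OF assms] by measurable

lemma step_nonneg: "0 \<le> step f n p"
  unfolding step_def by (intro sum_nonneg) auto

lemma step_le:
  assumes "f p \<ge> 0"
  shows "step f n p \<le> f p"
proof -
  have "real_of_int \<lfloor>min (real n) (f p) * 2 ^ n\<rfloor> \<le> min (real n) (f p) * 2 ^ n" by linarith
  also have "\<dots> \<le> f p * 2 ^ n" by (intro mult_right_mono) auto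
  finally show ?thesis using assms by (simp add: step_eq divide_le_eq)
qed

lemma step_mono:
  assumes "f p \<ge> 0"
  shows "incseq (\<lambda>n. step f n p)"
proof (rule incseq_SucI)
  fix n
  show "step f n p \<le> step f (Suc n) p"
  proof (cases "norm (fst p) \<le> real n")
    case True
    have "min (real n) (f p) * 2 ^ n \<le> min (real (Suc n)) (f p) * 2 ^ n"
      by (intro mult_right_mono) auto
    \<comment> \<open>Refining the dyadic grid: twice a floor is at most the floor of the
      double.\<close>
    then have "2 * \<lfloor>min (real n) (f p) * 2 ^ n\<rfloor> \<le> \<lfloor>2 * (min (real (Suc n)) (f p) * 2 ^ n)\<rfloor>"
      by linarith
    then have "real_of_int (2 * \<lfloor>min (real n) (f p) * 2 ^ n\<rfloor>) \<le>
               real_of_int \<lfloor>2 * (min (real (Suc n)) (f p) * 2 ^ n)\<rfloor>"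
      by (rule of_int_le_iff[THEN iffD2])
    then show ?thesis
      using True assms by (simp add: step_eq field_simps)
  next
    case False
    then show ?thesis using step_nonneg[of f "Suc n" p] assms by (simp add: step_eq)
  qed
qed

lemma step_tendsto:
  assumes "f p \<ge> 0"
  shows "(\<lambda>n. step f n p) \<longlonglongrightarrow> f p"
proof (rule real_tendsto_sandwich)
  show "\<forall>\<^sub>F n in sequentially. step f n p \<le> f p" using step_le[of f p] assms by simp
  \<comment> \<open>Once n exceeds both the radius and the value, only the rounding error of at most
    one dyadic unit remains.\<close>
  show "\<forall>\<^sub>F n in sequentially. f p - 1 / 2 ^ n \<le> step f n p"
    using eventually_ge_at_top[of "nat \<lceil>max (norm (fst p)) (f p)\<rceil>"]
  proof eventually_elim
    case (elim n)
    then have n: "norm (fst p) \<le> real n" "f p \<le> real n" by linarith+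
    have "f p * 2 ^ n - 1 \<le> real_of_int \<lfloor>f p * 2 ^ n\<rfloor>" by linarith
    then show ?case using n assms by (simp add: step_eq min_def pos_le_divide_eq left_diff_distrib)
  qed
  have "(\<lambda>n. f p - (1 / 2) ^ n) \<longlonglongrightarrow> f p - 0"
    by (intro tendsto_diff tendsto_const LIMSEQ_realpow_zero) auto
  then show "(\<lambda>n. f p - 1 / 2 ^ n) \<longlonglongrightarrow> f p" by (simp add: power_divide)
qed simp

lemma nn_integral_step_count_space:
  assumes "\<And>i. finite (\<Phi> \<inter> level_set f n i)" "c \<ge> 0"
  shows "(\<integral>\<^sup>+ p. ennreal (c * step f n p) \<partial>count_space \<Phi>) =
         ennreal (\<Sum>i<levels n. c * (real i / 2 ^ n) * real (card (\<Phi> \<inter> level_set f n i)))"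
proof -
  have step_sum: "ennreal (c * step f n p) =
      (\<Sum>i<levels n. ennreal (c * (real i / 2 ^ n)) * indicator (level_set f n i) p)" for p
  proof -
    have "ennreal (c * step f n p) = (\<Sum>i<levels n. ennreal (c * (real i / 2 ^ n) * indicator (level_set f n i) p))"
      using assms(2) by (subst sum_ennreal) (auto simp: step_def sum_distrib_left mult_ac)
    also have "\<dots> = (\<Sum>i<levels n. ennreal (c * (real i / 2 ^ n)) * indicator (level_set f n i) p)"
      by (intro sum.cong refl) (simp split: split_indicator)
    finally show ?thesis .
  qed
  have count: "(\<integral>\<^sup>+ p. indicator (level_set f n i) p \<partial>count_space \<Phi>) =
      ennreal (real (card (\<Phi> \<inter> level_set f n i)))" for i
  proof -
    have "(\<integral>\<^sup>+ p. indicator (level_set f n i) p \<partial>count_space \<Phi>) =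
        (\<integral>\<^sup>+ p. indicator (\<Phi> \<inter> level_set f n i) p \<partial>count_space \<Phi>)"
      by (intro nn_integral_cong) (auto split: split_indicator)
    also have "\<dots> = emeasure (count_space \<Phi>) (\<Phi> \<inter> level_set f n i)"
      by (rule nn_integral_indicator) auto
    \<comment> \<open>The finiteness assumption enters here: \<open>card\<close> of an infinite set
      would be 0.\<close>
    also have "\<dots> = ennreal (real (card (\<Phi> \<inter> level_set f n i)))"
      using assms(1)[of i] by (subst emeasure_count_space_finite) (auto simp: ennreal_of_nat_eq_real_of_nat)
    finally show ?thesis .
  qed
  have "(\<integral>\<^sup>+ p. ennreal (c * step f n p) \<partial>count_space \<Phi>) =
      (\<Sum>i<levels n. \<integral>\<^sup>+ p. ennreal (c * (real i / 2 ^ n)) * indicator (level_set f n i) p \<partial>count_space \<Phi>)"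
    unfolding step_sum by (rule nn_integral_sum) auto
  also have "\<dots> = (\<Sum>i<levels n. ennreal (c * (real i / 2 ^ n)) * (\<integral>\<^sup>+ p. indicator (level_set f n i) p \<partial>count_space \<Phi>))"
    by (intro sum.cong refl nn_integral_cmult) auto
  finally show ?thesis
    using assms(2) by (simp add: count ennreal_mult[symmetric])
qed

lemma laplace_exponent_step:
  assumes "f \<in> borel_measurable borel" "sets M = sets borel"
    and f: "integrable M f" "\<And>p. f p \<ge> 0" and "q \<ge> 0" "x \<ge> 0"
  shows "(\<integral>p. 1 - exp (- x * (q * step f n p)) \<partial>M) =
         (\<Sum>i<levels n. (1 - exp (- x * (q * (real i / 2 ^ n)))) * measure M (level_set f n i))"
proof -
  note [measurable] = level_set_sets[OF assms(1)] and [measurable_cong] = assms(2)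
  let ?h = "\<lambda>v. 1 - exp (- x * (q * v))"
  have "(\<integral>p. ?h (step f n p) \<partial>M) =
        (\<integral>p. (\<Sum>i<levels n. ?h (real i / 2 ^ n) * indicator (level_set f n i) p) \<partial>M)"
    by (intro Bochner_Integration.integral_cong refl comp_step[where h="?h"]) (use f in auto)
  also have "\<dots> = (\<Sum>i<levels n. \<integral>p. ?h (real i / 2 ^ n) * indicator (level_set f n i) p \<partial>M)"
  proof (intro Bochner_Integration.integral_sum)
    fix i assume i: "i \<in> {..<levels n}"
    have nn: "?h (real j / 2 ^ n) \<ge> 0" for j using assms by simp
    \<comment> \<open>One summand is at most the whole nonnegative sum, which is
      \<open>?h (step f n p)\<close> and thus at most \<open>x * q * f p\<close>. This avoids
      discussing whether each level set has finite measure.\<close>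
    show "integrable M (\<lambda>p. ?h (real i / 2 ^ n) * indicator (level_set f n i) p)"
    proof (rule Bochner_Integration.integrable_bound[OF f(1)[THEN integrable_mult_right, of "x * q"]])
      show "AE p in M. norm (?h (real i / 2 ^ n) * indicator (level_set f n i) p) \<le> norm (x * q * f p)"
      proof (rule AE_I2)
        fix p
        have "?h (real i / 2 ^ n) * indicator (level_set f n i) p \<le>
          (\<Sum>i<levels n. ?h (real i / 2 ^ n) * indicator (level_set f n i) p)"
          using nn i by (intro member_le_sum) auto
        also have "\<dots> = ?h (step f n p)" by (rule comp_step[symmetric]) (use f in auto)
        also have "\<dots> \<le> x * (q * step f n p)"
          using exp_ge_add_one_self[of "- x * (q * step f n p)"] by simp
        also have "\<dots> \<le> x * q * f p"
          using step_le[of f p n, OF f(2)] assms by (simp add: mult.assoc mult_left_mono)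
        finally show "norm (?h (real i / 2 ^ n) * indicator (level_set f n i) p) \<le> norm (x * q * f p)"
          using nn[of i] assms by (simp add: abs_mult)
      qed
    qed (use assms in measurable)
  qed
  also have "\<dots> = (\<Sum>i<levels n. ?h (real i / 2 ^ n) * measure M (level_set f n i))"
    using sets.sets_into_space[of _ M] level_set_sets[OF assms(1)] assms(2)
    by (intro sum.cong refl) (simp add: Int_absorb2)
  finally show ?thesis .
qed

section \<open>The coverage probability\<close>

text \<open>The recurrence reads only arguments of index at least 1. Hence an additive constant in
  the exponent, which changes order 0 only, leaves the Bell polynomials alone.\<close>

lemma bell_cong:
  assumes "\<And>j. j \<ge> 1 \<Longrightarrow> x j = y j"
  shows "bell m x = bell m y"
proof (induction m rule: less_induct)
  case (less m)
  show ?case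
  proof (cases m)
    case (Suc n)
    then show ?thesis by (auto intro!: sum.cong arg_cong2[where f="(*)"] less assms)
  qed simp
qed

lemma poisson_prob_le_1: "mu \<ge> 0 \<Longrightarrow> poisson_prob mu n \<le> 1"
  using pmf_le_1[of "pois mu" n] by (simp add: pmf_pois)

lemma poisson_prob_measurable [measurable]: "(\<lambda>mu. poisson_prob mu n) \<in> borel_measurable borel"
  unfolding poisson_prob_def by measurable

lemma erlang_tail_measurable [measurable]: "erlang_tail k \<in> borel_measurable borel"
  unfolding erlang_tail_def[abs_def] by measurable

lemma r1_density_measurable [measurable]: "r1_density lam \<in> borel_measurable borel"
  unfolding r1_density_def[abs_def] by measurable

lemma beta_pos: "0 < bT \<Longrightarrow> bT < 1 \<Longrightarrow> beta bT c > 0"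
  by (cases c) (auto simp: beta_def)

text \<open>The parameter r occurs only in the indicator of the density; written as an
  \<open>if\<close>, the integrand is visibly jointly measurable in r and the point.\<close>

lemma measure_mark_intensity_measurable:
  assumes [measurable]: "A \<in> sets borel"
  shows "(\<lambda>r. measure (mark_intensity lam thI r) A) \<in> borel_measurable borel"
proof -
  have "emeasure (mark_intensity lam thI r) A =
      (\<integral>\<^sup>+ p. ennreal (lam / 2 * (if norm (fst p) > r then 1 else 0) * exponential_density (1 / thI) (snd p))
         * indicator A p \<partial>lborel)" for r
    unfolding mark_intensity_def
    by (subst emeasure_density) (auto intro!: nn_integral_cong split: split_indicator)
  then show ?thesis unfolding measure_def by simp measurable
qed

section \<open>The model with its discretised loads and counts\<close>

locale star_ris = prob_space M for M :: "'w measure" +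
  fixes lam PB Cr thr thI dc n0 \<alpha> bT aT aC tau :: real
    and k :: nat
    and r1 G :: "'w \<Rightarrow> real"
    and chi :: "'w \<Rightarrow> mode"
    and PhiT PhiR :: "'w \<Rightarrow> mark set"
  assumes params: "lam > 0" "PB > 0" "Cr > 0" "thr > 0" "thI > 0" "dc > 0" "\<alpha> > 2" "k \<ge> 1"
      "0 < bT" "bT < 1" "0 < aT" "aT < aC" "aT + aC = 1" "tau > 0"
    and cond: "aC > aT * tau"
    and meas [measurable]: "r1 \<in> borel_measurable M" "G \<in> borel_measurable M"
      "chi \<in> measurable M (count_space UNIV)"
    and card_meas: "\<And>A. A \<in> sets borel \<Longrightarrow> bounded (fst ` A) \<Longrightarrow>
          (\<lambda>w. card (PhiT w \<inter> A)) \<in> measurable M (count_space UNIV)"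
      "\<And>A. A \<in> sets borel \<Longrightarrow> bounded (fst ` A) \<Longrightarrow>
          (\<lambda>w. card (PhiR w \<inter> A)) \<in> measurable M (count_space UNIV)"
    and locfin: "\<And>w A. w \<in> space M \<Longrightarrow> bounded (fst ` A) \<Longrightarrow> finite (PhiT w \<inter> A)"
      "\<And>w A. w \<in> space M \<Longrightarrow> bounded (fst ` A) \<Longrightarrow> finite (PhiR w \<inter> A)"
    and law: "\<And>B c C (As :: nat \<Rightarrow> mark set) n ns (As' :: nat \<Rightarrow> mark set) m ms.
      B \<in> sets borel \<Longrightarrow> C \<in> sets borel \<Longrightarrow>
      disjoint_family_on As {..<n} \<Longrightarrow> (\<forall>i<n. As i \<in> sets borel \<and> bounded (fst ` As i)) \<Longrightarrow>
      disjoint_family_on As' {..<m} \<Longrightarrow> (\<forall>j<m. As' j \<in> sets borel \<and> bounded (fst ` As' j)) \<Longrightarrow>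
      measure M {w \<in> space M. r1 w \<in> B \<and> chi w = c \<and> G w \<in> C
          \<and> (\<forall>i<n. card (PhiT w \<inter> As i) = ns i) \<and> (\<forall>j<m. card (PhiR w \<inter> As' j) = ms j)}
      = (\<integral>r. indicator B r * r1_density lam r * (1 / 2) * measure (gamma_measure k thr) C
            * (\<Prod>i<n. poisson_prob (measure (mark_intensity lam thI r) (As i)) (ns i))
            * (\<Prod>j<m. poisson_prob (measure (mark_intensity lam thI r) (As' j)) (ms j)) \<partial>lborel)"
begin

definition tauS :: real where "tauS = tau / (aC - aT * tau)"

text \<open>This is the number s of the theorem: coverage means that \<open>G\<close> exceeds
  \<open>thr * sfac c r\<close> times noise plus interference.\<close>

definition sfac :: "mode \<Rightarrow> real \<Rightarrow> real" where
  "sfac c r = tauS * (r * dc) powr \<alpha> / (thr * beta bT c * PB * Cr)"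

definition Phi :: "mode \<Rightarrow> 'w \<Rightarrow> mark set" where
  "Phi md w = (case md of T \<Rightarrow> PhiT w | R \<Rightarrow> PhiR w)"

text \<open>The modes cross: points of \<open>PhiT\<close> carry the coefficient of R and vice
  versa, so \<open>PhiT\<close> produces the term of \<open>Lam\<close> with D at R.\<close>

definition coef :: "mode \<Rightarrow> real" where
  "coef md = (case md of T \<Rightarrow> beta bT R | R \<Rightarrow> beta bT T) * PB * Cr"

abbreviation gain :: "mark \<Rightarrow> real" where "gain \<equiv> path_gain \<alpha> dc"

definition Idx :: "nat \<Rightarrow> (mode \<times> nat) set" where "Idx n = {T, R} \<times> {..<levels n}"

text \<open>The value 0 off \<open>Idx n\<close> matches the default of \<open>Pi_pmf\<close> in
  \<open>count_law\<close> and places every outcome in \<open>count_vectors n\<close>.\<close>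

definition counts :: "nat \<Rightarrow> 'w \<Rightarrow> mode \<times> nat \<Rightarrow> nat" where
  "counts n w j = (if j \<in> Idx n then card (Phi (fst j) w \<inter> level_set gain n (snd j)) else 0)"

text \<open>Noise plus discretised interference in the unit of \<open>G / thr\<close>.\<close>

definition load :: "nat \<Rightarrow> mode \<Rightarrow> real \<Rightarrow> (mode \<times> nat \<Rightarrow> nat) \<Rightarrow> real" where
  "load n c r v = sfac c r * n0\<^sup>2 +
     (\<Sum>j\<in>Idx n. (sfac c r * coef (fst j) * (real (snd j) / 2 ^ n)) * real (v j))"

definition rate :: "nat \<Rightarrow> real \<Rightarrow> mode \<times> nat \<Rightarrow> real" where
  "rate n r j = measure (mark_intensity lam thI r) (level_set gain n (snd j))"

definition count_law :: "nat \<Rightarrow> real \<Rightarrow> (mode \<times> nat \<Rightarrow> nat) pmf" where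
  "count_law n r = Pi_pmf (Idx n) 0 (\<lambda>j. pois (rate n r j))"

lemma tauS_pos: "tauS > 0"
  using params cond by (simp add: tauS_def)

lemma sfac_nonneg: "sfac c r \<ge> 0"
  using tauS_pos params beta_pos[of bT c] by (simp add: sfac_def)

lemma sfac_pos: "r \<noteq> 0 \<Longrightarrow> sfac c r > 0"
  using tauS_pos params beta_pos[of bT c] by (simp add: sfac_def)

lemma sfac_measurable [measurable]: "sfac c \<in> borel_measurable borel"
  unfolding sfac_def[abs_def] by measurable

lemma coef_pos: "coef md > 0"
  using params beta_pos[of bT] by (cases md) (auto simp: coef_def)

lemma finite_Idx [simp]: "finite (Idx n)"
  by (simp add: Idx_def)

lemma rate_nonneg: "rate n r j \<ge> 0"
  by (simp add: rate_def)

lemma rate_measurable [measurable]: "(\<lambda>r. rate n r j) \<in> borel_measurable borel"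
  unfolding rate_def by (intro measure_mark_intensity_measurable level_set_sets) simp

lemma load_nonneg: "load n c r v \<ge> 0"
  unfolding load_def using sfac_nonneg coef_pos
  by (intro add_nonneg_nonneg sum_nonneg mult_nonneg_nonneg) (auto simp: less_imp_le)

lemma load_measurable [measurable]: "(\<lambda>r. load n c r v) \<in> borel_measurable borel"
  unfolding load_def by measurable

lemma counts_measurable [measurable]:
  "(\<lambda>w. counts n w j) \<in> measurable M (count_space UNIV)"
proof (cases "j \<in> Idx n")
  case True
  then show ?thesis
    by (cases "fst j") (simp_all add: counts_def Phi_def card_meas level_set_sets level_set_bounded)
qed (simp add: counts_def)

section \<open>Joint law of mode, distance, fading and counts\<close>

interpretation gamma: prob_space "gamma_measure k thr"
  unfolding gamma_measure_def using params by (intro prob_space_erlang_density) auto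

lemma gamma_measure_simps [simp]:
  "space (gamma_measure k thr) = UNIV" "sets (gamma_measure k thr) = sets borel"
  by (auto simp: gamma_measure_def)

lemma prob_chi:
  assumes "B \<in> sets borel"
  shows "measure M {w \<in> space M. r1 w \<in> B \<and> chi w = c} = (\<integral>r. indicator B r * r1_density lam r / 2 \<partial>lborel)"
  \<comment> \<open>The instance with no counting sets at all and full mass for the gamma
    law.\<close>
  using law[of B UNIV "\<lambda>_. {}" 0 "\<lambda>_. {}" 0 c] assms gamma.prob_space by (simp add: disjoint_family_on_def)

lemma prob_split_chi:
  assumes [measurable]: "Measurable.pred M P"
  shows "measure M {w \<in> space M. P w} =
         measure M {w \<in> space M. P w \<and> chi w = T} + measure M {w \<in> space M. P w \<and> chi w = R}"
proof -
  have "{w \<in> space M. P w} = {w \<in> space M. P w \<and> chi w = T} \<union> {w \<in> space M. P w \<and> chi w = R}"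
    by (auto intro: mode.exhaust)
  then show ?thesis by (simp only:) (rule finite_measure_Union; auto)
qed

text \<open>No integration is carried out: \<open>prob_chi\<close> gives both modes the same
  probability, and the two sum to 1. Integrability follows because the Bochner integral of a
  non-integrable function is 0.\<close>

lemma half_density: "(\<integral>r. r1_density lam r / 2 \<partial>lborel) = 1 / 2"
  and integrable_half_density: "integrable lborel (\<lambda>r. r1_density lam r / 2)"
proof -
  show *: "(\<integral>r. r1_density lam r / 2 \<partial>lborel) = 1 / 2"
    using prob_split_chi[of "\<lambda>_. True"] prob_chi[of UNIV T] prob_chi[of UNIV R] prob_space by simp
  show "integrable lborel (\<lambda>r. r1_density lam r / 2)"
    using * by (metis not_integrable_integral_eq zero_neq_one divide_eq_0_iff zero_neq_numeral)
qed

lemma r1_density_nonneg: "r1_density lam r \<ge> 0"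
  using params by (simp add: r1_density_def)

lemma prob_chi_r1_pos: "measure M {w \<in> space M. r1 w \<in> {0<..} \<and> chi w = c} = 1 / 2"
proof -
  have "(\<integral>r. indicator {0<..} r * r1_density lam r / 2 \<partial>lborel) = (\<integral>r. r1_density lam r / 2 \<partial>lborel)"
    by (intro Bochner_Integration.integral_cong) (auto simp: r1_density_def split: split_indicator)
  then show ?thesis using prob_chi[of "{0<..}" c] half_density by simp
qed

text \<open>Density in r of the joint law of \<open>r1\<close>, one fixed mode (the factor 1/2) and
  the count vector v.\<close>

definition weight :: "nat \<Rightarrow> (mode \<times> nat \<Rightarrow> nat) \<Rightarrow> real \<Rightarrow> real" where
  "weight n v r = r1_density lam r / 2 * (\<Prod>j\<in>Idx n. poisson_prob (rate n r j) (v j))"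

lemma weight_measurable [measurable]: "weight n v \<in> borel_measurable borel"
  unfolding weight_def[abs_def] by measurable

lemma weight_nonneg: "weight n v r \<ge> 0"
  unfolding weight_def using r1_density_nonneg rate_nonneg
  by (intro mult_nonneg_nonneg prod_nonneg) (auto simp: poisson_prob_nonneg)

lemma weight_le: "weight n v r \<le> r1_density lam r / 2"
  unfolding weight_def using r1_density_nonneg[of r] rate_nonneg
  by (intro mult_left_le prod_le_1) (auto simp: poisson_prob_nonneg poisson_prob_le_1)

lemma integrable_weight: "integrable lborel (weight n v)"
  by (rule Bochner_Integration.integrable_bound[OF integrable_half_density])
     (use weight_le weight_nonneg in \<open>auto simp: abs_of_nonneg r1_density_nonneg\<close>)

lemma joint_law_rectangle:
  assumes [measurable]: "B \<in> sets borel" "C \<in> sets borel"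
  shows "emeasure M {w \<in> space M. chi w = c \<and> (\<forall>j\<in>Idx n. counts n w j = v j) \<and> r1 w \<in> B \<and> G w \<in> C} =
         (\<integral>\<^sup>+ r. ennreal (weight n v r) * indicator B r \<partial>lborel) * emeasure (gamma_measure k thr) C"
proof -
  have prods: "(\<Prod>j\<in>Idx n. poisson_prob (rate n r j) (v j)) =
      (\<Prod>i<levels n. poisson_prob (measure (mark_intensity lam thI r) (level_set gain n i)) (v (T, i))) *
      (\<Prod>i<levels n. poisson_prob (measure (mark_intensity lam thI r) (level_set gain n i)) (v (R, i)))" for r
  proof -
    have "(\<Prod>j\<in>Idx n. poisson_prob (rate n r j) (v j)) = (\<Prod>md\<in>{T, R}. \<Prod>i<levels n.
        poisson_prob (measure (mark_intensity lam thI r) (level_set gain n i)) (v (md, i)))"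
      unfolding Idx_def prod.cartesian_product by (intro prod.cong) (auto simp: rate_def)
    then show ?thesis by simp
  qed
  have "{w \<in> space M. chi w = c \<and> (\<forall>j\<in>Idx n. counts n w j = v j) \<and> r1 w \<in> B \<and> G w \<in> C} =
    {w \<in> space M. r1 w \<in> B \<and> chi w = c \<and> G w \<in> C
      \<and> (\<forall>i<levels n. card (PhiT w \<inter> level_set gain n i) = v (T, i))
      \<and> (\<forall>i<levels n. card (PhiR w \<inter> level_set gain n i) = v (R, i))}"
    by (auto simp: Idx_def counts_def Phi_def)
  then have "measure M {w \<in> space M. chi w = c \<and> (\<forall>j\<in>Idx n. counts n w j = v j) \<and> r1 w \<in> B \<and> G w \<in> C} =
    (\<integral>r. measure (gamma_measure k thr) C * (weight n v r * indicator B r) \<partial>lborel)"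
    using law[of B C "level_set gain n" "levels n" "level_set gain n" "levels n" c
        "\<lambda>i. v (T, i)" "\<lambda>i. v (R, i)"]
    by (simp add: level_set_disjoint level_set_sets level_set_bounded weight_def prods mult_ac)
  also have "\<dots> = measure (gamma_measure k thr) C * (\<integral>r. weight n v r * indicator B r \<partial>lborel)"
    by simp
  finally have *: "measure M {w \<in> space M. chi w = c \<and> (\<forall>j\<in>Idx n. counts n w j = v j) \<and> r1 w \<in> B \<and> G w \<in> C} =
    measure (gamma_measure k thr) C * (\<integral>r. weight n v r * indicator B r \<partial>lborel)" .
  have "integrable lborel (\<lambda>r. weight n v r * indicator B r)"
    by (intro integrable_real_mult_indicator integrable_weight) auto
  then have "(\<integral>\<^sup>+ r. ennreal (weight n v r * indicator B r) \<partial>lborel) =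
      ennreal (\<integral>r. weight n v r * indicator B r \<partial>lborel)"
    by (intro nn_integral_eq_integral) (auto simp: weight_nonneg)
  moreover have "(\<integral>\<^sup>+ r. ennreal (weight n v r * indicator B r) \<partial>lborel) =
      (\<integral>\<^sup>+ r. ennreal (weight n v r) * indicator B r \<partial>lborel)"
    by (intro nn_integral_cong) (auto split: split_indicator)
  moreover have "0 \<le> (\<integral>r. weight n v r * indicator B r \<partial>lborel)"
    by (intro Bochner_Integration.integral_nonneg) (auto simp: weight_nonneg)
  ultimately show ?thesis
    using * by (simp add: emeasure_eq_measure gamma.emeasure_eq_measure ennreal_mult'' mult.commute)
qed

text \<open>Coverage compares \<open>G\<close> with a function of \<open>r1\<close>, so rectangles
  do not suffice. On the event fixing mode and counts, the image law of \<open>(r1, G)\<close>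
  agrees on rectangles with a product measure, hence everywhere, and Z is measured by its
  sections.\<close>

lemma joint_law:
  assumes Z [measurable]: "Z \<in> sets (borel \<Otimes>\<^sub>M borel)"
  shows "emeasure M {w \<in> space M. chi w = c \<and> (\<forall>j\<in>Idx n. counts n w j = v j) \<and> (r1 w, G w) \<in> Z} =
         (\<integral>\<^sup>+ r. ennreal (weight n v r) * emeasure (gamma_measure k thr) (Pair r -` Z) \<partial>lborel)"
proof -
  define E where "E = {w \<in> space M. chi w = c \<and> (\<forall>j\<in>Idx n. counts n w j = v j)}"
  have [measurable]: "E \<in> sets M"
    unfolding E_def by measurable
  define N1 where "N1 = density lborel (\<lambda>r. ennreal (weight n v r))"
  define N where "N = distr (restrict_space M E) (borel \<Otimes>\<^sub>M borel) (\<lambda>w. (r1 w, G w))"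
  have [measurable]: "(\<lambda>w. (r1 w, G w)) \<in> restrict_space M E \<rightarrow>\<^sub>M borel \<Otimes>\<^sub>M borel"
    by (rule measurable_restrict_space1) measurable
  have emN: "emeasure N X = emeasure M {w \<in> space M. chi w = c \<and> (\<forall>j\<in>Idx n. counts n w j = v j) \<and> (r1 w, G w) \<in> X}"
    if [measurable]: "X \<in> sets (borel \<Otimes>\<^sub>M borel)" for X
  proof -
    have "emeasure N X = emeasure (restrict_space M E) ((\<lambda>w. (r1 w, G w)) -` X \<inter> space (restrict_space M E))"
      unfolding N_def by (rule emeasure_distr) measurable
    also have "\<dots> = emeasure M ((\<lambda>w. (r1 w, G w)) -` X \<inter> space (restrict_space M E))"
      by (rule emeasure_restrict_space) (auto simp: space_restrict_space)
    also have "(\<lambda>w. (r1 w, G w)) -` X \<inter> space (restrict_space M E) =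
      {w \<in> space M. chi w = c \<and> (\<forall>j\<in>Idx n. counts n w j = v j) \<and> (r1 w, G w) \<in> X}"
      by (auto simp: space_restrict_space E_def)
    finally show ?thesis .
  qed
  interpret N1: finite_measure N1
    using integrable_weight[of n v] weight_nonneg
    by (intro finite_measureI) (auto simp: N1_def emeasure_density nn_integral_eq_integral)
  have "N1 \<Otimes>\<^sub>M gamma_measure k thr = N"
  proof (rule pair_measure_eqI)
    show "sets (N1 \<Otimes>\<^sub>M gamma_measure k thr) = sets N"
      by (simp add: N_def) (rule sets_pair_measure_cong; simp add: N1_def)
    fix A B assume "A \<in> sets N1" "B \<in> sets (gamma_measure k thr)"
    then have [measurable]: "A \<in> sets borel" "B \<in> sets borel" by (auto simp: N1_def)
    show "emeasure N1 A * emeasure (gamma_measure k thr) B = emeasure N (A \<times> B)"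
      using joint_law_rectangle[of A B c n v]
      by (simp add: emN N1_def emeasure_density)
  qed unfold_locales
  then have "emeasure N Z = emeasure (N1 \<Otimes>\<^sub>M gamma_measure k thr) Z" by simp
  also have "\<dots> = (\<integral>\<^sup>+ r. emeasure (gamma_measure k thr) (Pair r -` Z) \<partial>N1)"
  proof (rule gamma.emeasure_pair_measure_alt)
    have "sets (N1 \<Otimes>\<^sub>M gamma_measure k thr) = sets (borel \<Otimes>\<^sub>M borel)"
      by (rule sets_pair_measure_cong) (simp_all add: N1_def)
    then show "Z \<in> sets (N1 \<Otimes>\<^sub>M gamma_measure k thr)" by simp
  qed
  also have "\<dots> = (\<integral>\<^sup>+ r. ennreal (weight n v r) * emeasure (gamma_measure k thr) (Pair r -` Z) \<partial>lborel)"
  proof -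
    have "(\<lambda>r. emeasure (gamma_measure k thr) (Pair r -` Z)) \<in> borel_measurable borel"
    proof (rule gamma.measurable_emeasure_Pair)
      have "sets (borel \<Otimes>\<^sub>M gamma_measure k thr) = sets (borel \<Otimes>\<^sub>M borel)"
        by (rule sets_pair_measure_cong) simp_all
      then show "Z \<in> sets (borel \<Otimes>\<^sub>M gamma_measure k thr)" by simp
    qed
    then show ?thesis unfolding N1_def by (intro nn_integral_density) auto
  qed
  finally show ?thesis by (simp add: emN)
qed

definition count_vectors :: "nat \<Rightarrow> (mode \<times> nat \<Rightarrow> nat) set" where
  "count_vectors n = {v. \<forall>j. j \<notin> Idx n \<longrightarrow> v j = 0}"

lemma count_vectors_0: "v \<in> count_vectors n \<Longrightarrow> j \<notin> Idx n \<Longrightarrow> v j = 0"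
  unfolding count_vectors_def by blast

text \<open>These vectors are the support of a product of Poisson laws of rate 1, and the support of
  a pmf is countable.\<close>

lemma countable_count_vectors: "countable (count_vectors n)"
proof -
  have "count_vectors n = set_pmf (Pi_pmf (Idx n) 0 (\<lambda>_. pois 1))"
    by (auto simp: set_Pi_pmf PiE_dflt_def count_vectors_def pois_def)
  then show ?thesis by simp
qed

section \<open>Coverage for a discretised load\<close>

definition disc_integrand :: "nat \<Rightarrow> mode \<Rightarrow> real \<Rightarrow> real \<Rightarrow> real" where
  "disc_integrand n c x r = r1_density lam r / 2 *
     measure_pmf.expectation (count_law n r) (\<lambda>v. erlang_tail k (x * load n c r v))"

lemma integrable_erlang_tail_load:
  assumes "x \<ge> 0"
  shows "integrable (count_law n r) (\<lambda>v. erlang_tail k (x * load n c r v))"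
  by (rule measure_pmf.integrable_const_bound[where B=1])
     (use assms erlang_tail_bounds load_nonneg in \<open>auto simp: abs_of_nonneg\<close>)

lemma expectation_erlang_tail_load_bounds:
  assumes "x \<ge> 0"
  shows "0 \<le> measure_pmf.expectation (count_law n r) (\<lambda>v. erlang_tail k (x * load n c r v))"
    and "measure_pmf.expectation (count_law n r) (\<lambda>v. erlang_tail k (x * load n c r v)) \<le> 1"
proof -
  show "0 \<le> measure_pmf.expectation (count_law n r) (\<lambda>v. erlang_tail k (x * load n c r v))"
    using assms load_nonneg by (intro Bochner_Integration.integral_nonneg erlang_tail_bounds) auto
  show "measure_pmf.expectation (count_law n r) (\<lambda>v. erlang_tail k (x * load n c r v)) \<le> 1"
    using assms load_nonneg
    by (intro measure_pmf.integral_le_const integrable_erlang_tail_load AE_I2 erlang_tail_bounds) auto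
qed

lemma disc_integrand_bounds:
  assumes "x \<ge> 0"
  shows "0 \<le> disc_integrand n c x r" "disc_integrand n c x r \<le> r1_density lam r / 2"
  unfolding disc_integrand_def
  using expectation_erlang_tail_load_bounds[OF assms, of n r c] r1_density_nonneg[of r]
  by (auto intro!: mult_left_le)

text \<open>Moves the dependence on r from the pmf into the integrand over a fixed countable space,
  where measurability in r and Tonelli's theorem are available.\<close>

lemma disc_integrand_eq_nn_integral:
  assumes "x \<ge> 0"
  shows "ennreal (disc_integrand n c x r) =
    (\<integral>\<^sup>+ v. ennreal (weight n v r) * ennreal (erlang_tail k (x * load n c r v)) \<partial>count_space (count_vectors n))"
proof -
  have pos: "erlang_tail k (x * load n c r v) \<ge> 0" for v
    using assms load_nonneg by (intro erlang_tail_bounds) auto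
  have "ennreal (disc_integrand n c x r) =
      ennreal (r1_density lam r / 2) * (\<integral>\<^sup>+ v. ennreal (erlang_tail k (x * load n c r v)) \<partial>count_law n r)"
  proof -
    have "(\<integral>\<^sup>+ v. ennreal (erlang_tail k (x * load n c r v)) \<partial>count_law n r) =
        ennreal (measure_pmf.expectation (count_law n r) (\<lambda>v. erlang_tail k (x * load n c r v)))"
      by (intro nn_integral_eq_integral integrable_erlang_tail_load assms AE_I2 pos)
    then show ?thesis
      unfolding disc_integrand_def using expectation_erlang_tail_load_bounds(1)[OF assms] r1_density_nonneg
      by (subst ennreal_mult) auto
  qed
  also have "(\<integral>\<^sup>+ v. ennreal (erlang_tail k (x * load n c r v)) \<partial>count_law n r) =
      (\<integral>\<^sup>+ v. ennreal (pmf (count_law n r) v) * ennreal (erlang_tail k (x * load n c r v)) \<partial>count_space UNIV)"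
    by (rule nn_integral_measure_pmf)
  also have "\<dots> = (\<integral>\<^sup>+ v. ennreal (\<Prod>j\<in>Idx n. poisson_prob (rate n r j) (v j)) *
      ennreal (erlang_tail k (x * load n c r v)) \<partial>count_space (count_vectors n))"
    by (subst (2) nn_integral_count_space_indicator)
       (auto intro!: nn_integral_cong simp: count_law_def pmf_Pi count_vectors_def pmf_pois rate_nonneg
          split: split_indicator)
  also have "ennreal (r1_density lam r / 2) * \<dots> =
    (\<integral>\<^sup>+ v. ennreal (r1_density lam r / 2) * (ennreal (\<Prod>j\<in>Idx n. poisson_prob (rate n r j) (v j)) *
      ennreal (erlang_tail k (x * load n c r v))) \<partial>count_space (count_vectors n))"
    by (rule nn_integral_cmult[symmetric]) auto
  also have "\<dots> = (\<integral>\<^sup>+ v. ennreal (weight n v r) * ennreal (erlang_tail k (x * load n c r v)) \<partial>count_space (count_vectors n))"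
  proof (intro nn_integral_cong)
    fix v
    have "ennreal (weight n v r) = ennreal (r1_density lam r / 2) *
        ennreal (\<Prod>j\<in>Idx n. poisson_prob (rate n r j) (v j))"
      unfolding weight_def
      by (rule ennreal_mult) (auto simp: r1_density_nonneg intro!: prod_nonneg poisson_prob_nonneg rate_nonneg)
    then show "ennreal (r1_density lam r / 2) * (ennreal (\<Prod>j\<in>Idx n. poisson_prob (rate n r j) (v j)) *
        ennreal (erlang_tail k (x * load n c r v))) =
      ennreal (weight n v r) * ennreal (erlang_tail k (x * load n c r v))"
      by (simp only: mult.assoc)
  qed
  finally show ?thesis .
qed

lemma disc_integrand_measurable:
  assumes "x \<ge> 0"
  shows "disc_integrand n c x \<in> borel_measurable borel"
proof -
  interpret cs: sigma_finite_measure "count_space (count_vectors n)"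
    by (rule sigma_finite_measure_count_space_countable[OF countable_count_vectors])
  have "(\<lambda>(v, r). ennreal (weight n v r) * ennreal (erlang_tail k (x * load n c r v)))
     \<in> borel_measurable (count_space (count_vectors n) \<Otimes>\<^sub>M borel)"
    by (rule measurable_pair_measure_countable1[OF countable_count_vectors]) (simp, measurable)
  from measurable_pair_swap[OF this]
  have "(\<lambda>r. \<integral>\<^sup>+ v. ennreal (weight n v r) * ennreal (erlang_tail k (x * load n c r v))
      \<partial>count_space (count_vectors n)) \<in> borel_measurable borel"
    by (intro cs.borel_measurable_nn_integral) (simp add: case_prod_unfold)
  then have "(\<lambda>r. enn2real (ennreal (disc_integrand n c x r))) \<in> borel_measurable borel"
    using assms by (simp add: disc_integrand_eq_nn_integral)
  then show ?thesis using disc_integrand_bounds(1)[OF assms] by simp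
qed

lemma integrable_disc_integrand:
  assumes "x \<ge> 0"
  shows "integrable lborel (disc_integrand n c x)"
  by (rule Bochner_Integration.integrable_bound[OF integrable_half_density])
     (use disc_integrand_bounds[OF assms] disc_integrand_measurable[OF assms] r1_density_nonneg in auto)

definition covered :: "nat \<Rightarrow> mode \<Rightarrow> real \<Rightarrow> 'w \<Rightarrow> bool" where
  "covered n c x w \<longleftrightarrow> chi w = c \<and> G w > thr * (x * load n c (r1 w) (counts n w))"

lemma covered_measurable [measurable]: "Measurable.pred M (covered n c x)"
  unfolding covered_def[abs_def] load_def by measurable

lemma prob_covered:
  assumes "x \<ge> 0"
  shows "measure M {w \<in> space M. covered n c x w} = (\<integral>r. disc_integrand n c x r \<partial>lborel)"
proof -
  define Z where "Z v = {p. snd p > thr * (x * load n c (fst p) v)}" for v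
  have Z [measurable]: "Z v \<in> sets (borel \<Otimes>\<^sub>M borel)" for v
  proof -
    have "{p \<in> space (borel \<Otimes>\<^sub>M borel). snd p > thr * (x * load n c (fst p) v)} \<in> sets (borel \<Otimes>\<^sub>M borel)"
      by measurable
    then show ?thesis by (simp add: Z_def space_pair_measure)
  qed
  define E where "E v = {w \<in> space M. chi w = c \<and> (\<forall>j\<in>Idx n. counts n w j = v j) \<and> (r1 w, G w) \<in> Z v}" for v
  have E: "E v \<in> sets M" for v
    unfolding E_def by measurable
  \<comment> \<open>Split by the realised count vector: on each piece the load is a function of
    \<open>r1\<close> alone, so \<open>joint_law\<close> applies.\<close>
  have eq: "{w \<in> space M. covered n c x w} = (\<Union>v\<in>count_vectors n. E v)"
  proof (intro equalityI subsetI)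
    fix w assume "w \<in> {w \<in> space M. covered n c x w}"
    then have "w \<in> E (counts n w)" "counts n w \<in> count_vectors n"
      by (auto simp: E_def covered_def Z_def count_vectors_def counts_def)
    then show "w \<in> (\<Union>v\<in>count_vectors n. E v)" by blast
  next
    fix w assume "w \<in> (\<Union>v\<in>count_vectors n. E v)"
    then obtain v where v: "v \<in> count_vectors n" "w \<in> E v" by blast
    then have "counts n w = v"
      by (intro ext) (auto simp: E_def count_vectors_def counts_def)
    then show "w \<in> {w \<in> space M. covered n c x w}"
      using v by (auto simp: E_def covered_def Z_def)
  qed
  have disj: "disjoint_family_on E (count_vectors n)"
  proof (unfold disjoint_family_on_def, intro ballI impI)
    fix u v assume uv: "u \<in> count_vectors n" "v \<in> count_vectors n" "u \<noteq> v"
    then obtain j where "u j \<noteq> v j" by (metis ext)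
    then have "j \<in> Idx n" using count_vectors_0[OF uv(1), of j] count_vectors_0[OF uv(2), of j] by metis
    then show "E u \<inter> E v = {}" using \<open>u j \<noteq> v j\<close> by (auto simp: E_def)
  qed
  have EZ: "emeasure M (E v) =
      (\<integral>\<^sup>+ r. ennreal (weight n v r) * ennreal (erlang_tail k (x * load n c r v)) \<partial>lborel)" for v
  proof -
    have "emeasure (gamma_measure k thr) (Pair r -` Z v) = ennreal (erlang_tail k (x * load n c r v))" for r
    proof -
      have "Pair r -` Z v = {thr * (x * load n c r v)<..}" by (auto simp: Z_def)
      then show ?thesis
        using params assms load_nonneg emeasure_gamma_measure_tail[of thr k "thr * (x * load n c r v)"]
        by simp
    qed
    then show ?thesis unfolding E_def by (subst joint_law) auto
  qed
  have "emeasure M {w \<in> space M. covered n c x w} = (\<integral>\<^sup>+ v. emeasure M (E v) \<partial>count_space (count_vectors n))"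
    unfolding eq by (rule emeasure_UN_countable[OF E countable_count_vectors disj])
  also have "\<dots> = (\<integral>\<^sup>+ r. \<integral>\<^sup>+ v. ennreal (weight n v r) * ennreal (erlang_tail k (x * load n c r v))
      \<partial>count_space (count_vectors n) \<partial>lborel)"
    unfolding EZ by (rule nn_integral_count_space_nn_integral[symmetric])
      (auto simp: countable_count_vectors)
  also have "\<dots> = (\<integral>\<^sup>+ r. ennreal (disc_integrand n c x r) \<partial>lborel)"
    using assms by (simp add: disc_integrand_eq_nn_integral)
  also have "\<dots> = ennreal (\<integral>r. disc_integrand n c x r \<partial>lborel)"
    using assms by (intro nn_integral_eq_integral integrable_disc_integrand AE_I2 disc_integrand_bounds)
  finally show ?thesis
    using disc_integrand_bounds(1)[OF assms]
    by (simp add: emeasure_eq_measure Bochner_Integration.integral_nonneg)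
qed

text \<open>The logarithm of the conditional Laplace transform of the load given \<open>r1 = r\<close>, when \<open>u\<close> is
  the contribution of a marked point, and its derivatives.\<close>

definition log_laplace :: "(mark \<Rightarrow> real) \<Rightarrow> mode \<Rightarrow> real \<Rightarrow> nat \<Rightarrow> real \<Rightarrow> real" where
  "log_laplace u c r j x =
     - (if j = 0 then sfac c r * n0\<^sup>2 * x else if j = 1 then sfac c r * n0\<^sup>2 else 0)
     - laplace_exponent (mark_intensity lam thI r) (\<lambda>p. sfac c r * coef T * u p) j x
     - laplace_exponent (mark_intensity lam thI r) (\<lambda>p. sfac c r * coef R * u p) j x"

lemma log_laplace_has_derivative:
  assumes "integrable (mark_intensity lam thI r) u" "\<And>p. u p \<ge> 0" "x > 0"
  shows "(log_laplace u c r j has_real_derivative log_laplace u c r (Suc j) x) (at x)"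
proof -
  have lin: "((\<lambda>x. if j = 0 then sfac c r * n0\<^sup>2 * x else if j = 1 then sfac c r * n0\<^sup>2 else 0) has_real_derivative
     (if Suc j = 0 then sfac c r * n0\<^sup>2 * x else if Suc j = 1 then sfac c r * n0\<^sup>2 else 0)) (at x)"
    by (cases "j = 0"; cases "j = 1") (auto intro!: derivative_eq_intros)
  show ?thesis
    unfolding log_laplace_def[abs_def] using assms sfac_nonneg[of c r] coef_pos
    by (intro derivative_intros lin laplace_exponent_has_derivative integrable_mult_right)
       (auto simp: less_imp_le)
qed

section \<open>The conditional Laplace transform and its limit under refinement\<close>

lemma integrable_gain: "r > 0 \<Longrightarrow> integrable (mark_intensity lam thI r) gain"
  using params by (intro integrable_path_gain) auto

lemma integrable_step:
  assumes "r > 0"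
  shows "integrable (mark_intensity lam thI r) (step gain n)"
proof (rule Bochner_Integration.integrable_bound[OF integrable_gain[OF assms]])
  show "step gain n \<in> borel_measurable (mark_intensity lam thI r)"
    using step_measurable[of gain n] by simp
qed (use step_le step_nonneg path_gain_nonneg in auto)

lemma log_laplace_step_tendsto:
  assumes "r > 0" "x > 0"
  shows "(\<lambda>n. log_laplace (step gain n) c r j x) \<longlonglongrightarrow> log_laplace gain c r j x"
proof -
  have "(\<lambda>n. laplace_exponent (mark_intensity lam thI r) (\<lambda>p. sfac c r * coef md * step gain n p) j x)
    \<longlonglongrightarrow> laplace_exponent (mark_intensity lam thI r) (\<lambda>p. sfac c r * coef md * gain p) j x" for md
  proof (rule laplace_exponent_tendsto)
    have nn: "sfac c r * coef md \<ge> 0" using sfac_nonneg[of c r] coef_pos[of md] by simp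
    show "integrable (mark_intensity lam thI r) (\<lambda>p. sfac c r * coef md * gain p)"
      using integrable_gain assms by simp
    show "(\<lambda>p. sfac c r * coef md * step gain n p) \<in> borel_measurable (mark_intensity lam thI r)" for n
      using step_measurable[of gain n] by simp
    show "0 \<le> sfac c r * coef md * step gain n p \<and> sfac c r * coef md * step gain n p \<le> sfac c r * coef md * gain p" for n p
      using nn step_nonneg[of gain n p] step_le[of gain p n] path_gain_nonneg[of \<alpha> dc p]
      by (auto intro!: mult_left_mono)
    show "(\<lambda>n. sfac c r * coef md * step gain n p) \<longlonglongrightarrow> sfac c r * coef md * gain p" for p
      by (intro tendsto_intros step_tendsto path_gain_nonneg)
  qed (use assms in auto)
  then show ?thesis unfolding log_laplace_def by (intro tendsto_intros)
qed

text \<open>Since \<open>step gain n\<close> is constant on level sets, the finite Poisson sum is an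
  integral against the intensity. The discretised load thus has the limiting form of the transform,
  with \<open>step gain n\<close> in place of \<open>gain\<close>.\<close>

lemma load_laplace:
  assumes "r > 0" "x > 0"
  shows "measure_pmf.expectation (count_law n r) (\<lambda>v. exp (- x * load n c r v)) =
         exp (log_laplace (step gain n) c r 0 x)"
proof -
  define q where "q md = sfac c r * coef md" for md
  have q: "q md \<ge> 0" for md using sfac_nonneg[of c r] coef_pos[of md] by (simp add: q_def)
  have "measure_pmf.expectation (count_law n r) (\<lambda>v. exp (- x * load n c r v)) =
     exp (- x * (sfac c r * n0\<^sup>2) -
       (\<Sum>j\<in>Idx n. (1 - exp (- x * (q (fst j) * (real (snd j) / 2 ^ n)))) * rate n r j))"
    unfolding count_law_def load_def q_def by (rule Pi_pois_laplace) (auto simp: rate_nonneg)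
  also have "(\<Sum>j\<in>Idx n. (1 - exp (- x * (q (fst j) * (real (snd j) / 2 ^ n)))) * rate n r j) =
      (\<Sum>md\<in>{T, R}. \<Sum>i<levels n. (1 - exp (- x * (q md * (real i / 2 ^ n)))) *
         measure (mark_intensity lam thI r) (level_set gain n i))"
    unfolding Idx_def sum.cartesian_product by (intro sum.cong) (auto simp: rate_def)
  also have "\<dots> = (\<Sum>md\<in>{T, R}. \<integral>p. 1 - exp (- x * (q md * step gain n p)) \<partial>mark_intensity lam thI r)"
    using assms q by (intro sum.cong refl laplace_exponent_step[symmetric])
      (auto simp: integrable_gain path_gain_nonneg)
  also have "- x * (sfac c r * n0\<^sup>2) - \<dots> = log_laplace (step gain n) c r 0 x"
    by (simp add: log_laplace_def laplace_exponent_def q_def mult_ac)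
  finally show ?thesis .
qed

lemma expectation_erlang_tail_load:
  assumes "r > 0" "x > 0"
  shows "measure_pmf.expectation (count_law n r) (\<lambda>v. erlang_tail k (x * load n c r v)) =
         bell_tail k (log_laplace (step gain n) c r) x"
proof (rule measure_pmf.expectation_erlang_tail)
  show "(log_laplace (step gain n) c r j has_real_derivative log_laplace (step gain n) c r (Suc j) x) (at x)"
    if "x > 0" for j x
    using that assms by (intro log_laplace_has_derivative integrable_step step_nonneg)
qed (use assms load_nonneg load_laplace in auto)

definition cov_integrand :: "mode \<Rightarrow> real \<Rightarrow> real \<Rightarrow> real" where
  "cov_integrand c x r = r1_density lam r / 2 * bell_tail k (log_laplace gain c r) x"

lemma bell_tail_step_tendsto:
  assumes "r > 0" "x > 0"
  shows "(\<lambda>n. bell_tail k (log_laplace (step gain n) c r) x) \<longlonglongrightarrow> bell_tail k (log_laplace gain c r) x"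
  unfolding bell_tail_def using assms
  by (intro tendsto_intros bell_tendsto log_laplace_step_tendsto)

text \<open>No random variable with transform \<open>exp (log_laplace gain c r 0 x)\<close> has been
  constructed, so both bounds are limits of those for \<open>step gain n\<close>, where the Bell
  tail is an expectation.\<close>

lemma bell_tail_gain_bounds:
  assumes "r > 0" "x > 0"
  shows "exp (log_laplace gain c r 0 x) \<le> bell_tail k (log_laplace gain c r) x"
    and "bell_tail k (log_laplace gain c r) x \<le> 1"
proof -
  show "bell_tail k (log_laplace gain c r) x \<le> 1"
    by (rule LIMSEQ_le_const2[OF bell_tail_step_tendsto[OF assms]])
       (use expectation_erlang_tail_load_bounds(2)[of x] assms in
          \<open>auto simp flip: expectation_erlang_tail_load\<close>)
  have "exp (log_laplace (step gain n) c r 0 x) \<le> bell_tail k (log_laplace (step gain n) c r) x" for n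
  proof -
    have "measure_pmf.expectation (count_law n r) (\<lambda>v. exp (- x * load n c r v)) \<le>
        measure_pmf.expectation (count_law n r) (\<lambda>v. erlang_tail k (x * load n c r v))"
    proof (rule integral_mono)
      show "integrable (count_law n r) (\<lambda>v. exp (- x * load n c r v))"
        using assms load_nonneg by (intro measure_pmf.integrable_const_bound[where B=1]) auto
      show "exp (- x * load n c r v) \<le> erlang_tail k (x * load n c r v)" for v
        using erlang_tail_bounds(3)[of "x * load n c r v" k] assms load_nonneg params by simp
    qed (use assms in \<open>auto intro!: integrable_erlang_tail_load\<close>)
    then show ?thesis by (simp only: load_laplace[OF assms] expectation_erlang_tail_load[OF assms])
  qed
  then show "exp (log_laplace gain c r 0 x) \<le> bell_tail k (log_laplace gain c r) x"
    using assms by (intro LIMSEQ_le[OF tendsto_exp[OF log_laplace_step_tendsto] bell_tail_step_tendsto]) auto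
qed

lemma disc_integrand_tendsto:
  assumes "x > 0"
  shows "(\<lambda>n. disc_integrand n c x r) \<longlonglongrightarrow> cov_integrand c x r"
proof (cases "r > 0")
  case True
  then show ?thesis
    unfolding disc_integrand_def cov_integrand_def using assms
    by (simp add: expectation_erlang_tail_load) (intro tendsto_intros bell_tail_step_tendsto; simp)
qed (simp add: disc_integrand_def cov_integrand_def r1_density_def)

text \<open>Being a pointwise limit of the discretised integrands spares an analysis of how the
  Laplace exponents and their derivatives depend on r.\<close>

lemma cov_integrand_measurable: "x > 0 \<Longrightarrow> cov_integrand c x \<in> borel_measurable borel"
  by (rule borel_measurable_LIMSEQ_real[OF disc_integrand_tendsto disc_integrand_measurable]) auto

lemma cov_integrand_bounds:
  assumes "x > 0"
  shows "0 \<le> cov_integrand c x r" "cov_integrand c x r \<le> r1_density lam r / 2"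
proof -
  show "0 \<le> cov_integrand c x r"
    by (rule LIMSEQ_le_const[OF disc_integrand_tendsto[OF assms]])
       (use disc_integrand_bounds assms in auto)
  show "cov_integrand c x r \<le> r1_density lam r / 2"
    by (rule LIMSEQ_le_const2[OF disc_integrand_tendsto[OF assms]])
       (use disc_integrand_bounds assms in auto)
qed

lemma integrable_cov_integrand: "x > 0 \<Longrightarrow> integrable lborel (cov_integrand c x)"
  by (rule Bochner_Integration.integrable_bound[OF integrable_half_density])
     (use cov_integrand_bounds cov_integrand_measurable r1_density_nonneg in auto)

text \<open>Half the density of \<open>r1\<close> dominates. Applied to arguments decreasing to 0,
  where the limit is 1, and to arguments decreasing to 1.\<close>

lemma integral_cov_integrand_tendsto:
  assumes X: "\<And>n. X n > 0"
    and lim: "\<And>r. r > 0 \<Longrightarrow> (\<lambda>n. bell_tail k (log_laplace gain c r) (X n)) \<longlonglongrightarrow> l r"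
    and l: "(\<lambda>r. r1_density lam r / 2 * l r) \<in> borel_measurable borel"
  shows "(\<lambda>n. \<integral>r. cov_integrand c (X n) r \<partial>lborel) \<longlonglongrightarrow> (\<integral>r. r1_density lam r / 2 * l r \<partial>lborel)"
proof (rule integral_dominated_convergence[OF _ _ integrable_half_density])
  show "AE r in lborel. (\<lambda>n. cov_integrand c (X n) r) \<longlonglongrightarrow> r1_density lam r / 2 * l r"
  proof (rule AE_I2)
    fix r :: real
    show "(\<lambda>n. cov_integrand c (X n) r) \<longlonglongrightarrow> r1_density lam r / 2 * l r"
    proof (cases "r > 0")
      case True
      then show ?thesis unfolding cov_integrand_def by (intro tendsto_intros lim)
    qed (simp add: cov_integrand_def r1_density_def)
  qed
qed (use X l cov_integrand_measurable cov_integrand_bounds in auto)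

section \<open>The interference as an extended real and its monotone approximation\<close>

definition itot :: "mode \<Rightarrow> 'w \<Rightarrow> ennreal" where
  "itot md w = (\<integral>\<^sup>+ p. ennreal (coef md * gain p) \<partial>count_space (Phi md w))"

definition disc_itot :: "nat \<Rightarrow> mode \<Rightarrow> 'w \<Rightarrow> real" where
  "disc_itot n md w = (\<Sum>i<levels n. coef md * (real i / 2 ^ n) * real (counts n w (md, i)))"

lemma load_counts:
  "load n c r (counts n w) = sfac c r * (n0\<^sup>2 + disc_itot n T w + disc_itot n R w)"
proof -
  have "(\<Sum>j\<in>Idx n. (sfac c r * coef (fst j) * (real (snd j) / 2 ^ n)) * real (counts n w j)) =
    (\<Sum>md\<in>{T, R}. \<Sum>i<levels n. sfac c r * (coef md * (real i / 2 ^ n) * real (counts n w (md, i))))"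
    unfolding Idx_def sum.cartesian_product by (intro sum.cong) (auto simp: mult_ac)
  then show ?thesis
    by (simp add: load_def disc_itot_def sum_distrib_left distrib_left add.assoc)
qed

lemma ennreal_disc_itot:
  assumes "w \<in> space M"
  shows "ennreal (disc_itot n md w) = (\<integral>\<^sup>+ p. ennreal (coef md * step gain n p) \<partial>count_space (Phi md w))"
proof -
  have "finite (Phi md w \<inter> level_set gain n i)" for i
    using locfin[OF assms level_set_bounded] by (cases md) (auto simp: Phi_def)
  then show ?thesis
    using coef_pos[of md]
    by (subst nn_integral_step_count_space)
       (cases md; auto simp: disc_itot_def counts_def Idx_def intro!: arg_cong[where f=ennreal] sum.cong)+
qed

lemma disc_itot_nonneg: "disc_itot n md w \<ge> 0"
  unfolding disc_itot_def using coef_pos[of md] by (intro sum_nonneg) (auto simp: less_imp_le)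

lemma disc_itot_incseq:
  assumes "w \<in> space M"
  shows "incseq (\<lambda>n. disc_itot n md w)"
proof (rule incseq_SucI)
  fix n
  have "ennreal (disc_itot n md w) \<le> ennreal (disc_itot (Suc n) md w)"
    unfolding ennreal_disc_itot[OF assms]
    using coef_pos[of md] step_mono[of gain, OF path_gain_nonneg]
    by (intro nn_integral_mono ennreal_leI mult_left_mono) (auto simp: incseq_Suc_iff)
  then show "disc_itot n md w \<le> disc_itot (Suc n) md w"
    by (simp add: disc_itot_nonneg)
qed

lemma disc_itot_tendsto:
  assumes "w \<in> space M"
  shows "(\<lambda>n. ennreal (disc_itot n md w)) \<longlonglongrightarrow> itot md w"
  unfolding ennreal_disc_itot[OF assms] itot_def
proof (rule nn_integral_LIMSEQ)
  show "incseq (\<lambda>n p. ennreal (coef md * step gain n p))"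
    using coef_pos[of md] step_mono[of gain, OF path_gain_nonneg]
    by (auto intro!: incseq_SucI le_funI ennreal_leI mult_left_mono simp: incseq_Suc_iff)
qed (auto intro!: tendsto_intros step_tendsto path_gain_nonneg)

lemma disc_itot_measurable [measurable]: "disc_itot n md \<in> borel_measurable M"
  unfolding disc_itot_def[abs_def] by measurable

text \<open>Only counts are measurable by assumption; the interference inherits measurability as a
  supremum of combinations of them.\<close>

lemma itot_measurable [measurable]: "itot md \<in> borel_measurable M"
proof -
  have "itot md w = (SUP n. ennreal (disc_itot n md w))" if "w \<in> space M" for w
  proof (rule LIMSEQ_unique[OF disc_itot_tendsto[OF that] LIMSEQ_SUP])
    show "incseq (\<lambda>n. ennreal (disc_itot n md w))"
      using disc_itot_incseq[OF that] by (auto simp: incseq_def intro!: ennreal_leI)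
  qed
  then show ?thesis by (subst measurable_cong) auto
qed

lemma disc_itot_finite:
  assumes "w \<in> space M" "itot md w < \<infinity>"
  shows "(\<lambda>n. disc_itot n md w) \<longlonglongrightarrow> enn2real (itot md w)"
    and "disc_itot n md w \<le> enn2real (itot md w)"
proof -
  have "(\<lambda>n. ennreal (disc_itot n md w)) \<longlonglongrightarrow> ennreal (enn2real (itot md w))"
    using disc_itot_tendsto[OF assms(1)] assms(2) by simp
  from tendsto_enn2real[OF this] show *: "(\<lambda>n. disc_itot n md w) \<longlonglongrightarrow> enn2real (itot md w)"
    by (simp add: disc_itot_nonneg)
  show "disc_itot n md w \<le> enn2real (itot md w)"
    by (rule incseq_le[OF disc_itot_incseq[OF assms(1)] *])
qed

lemma itot_finiteI:
  assumes "w \<in> space M" "\<And>n. disc_itot n md w \<le> B"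
  shows "itot md w < \<infinity>"
proof -
  have "itot md w \<le> ennreal B"
    by (rule LIMSEQ_le_const2[OF disc_itot_tendsto[OF assms(1)]]) (use assms(2) in \<open>auto intro!: ennreal_leI\<close>)
  then show ?thesis using ennreal_less_top le_less_trans by (metis infinity_ennreal_def)
qed

lemma interf_eq:
  "interf (beta bT R * PB * Cr) \<alpha> dc (PhiT w) = enn2real (itot T w)"
  "interf (beta bT T * PB * Cr) \<alpha> dc (PhiR w) = enn2real (itot R w)"
proof -
  have "ennreal (c * (norm (fst p) * dc) powr (- \<alpha>) * snd p) = ennreal (c * gain p)" if "c > 0" for c and p :: mark
  proof (cases "snd p \<ge> 0")
    case False
    then have "c * (norm (fst p) * dc) powr (- \<alpha>) * snd p \<le> 0"
      using that by (intro mult_nonneg_nonpos) auto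
    then show ?thesis using False by (simp add: path_gain_def ennreal_neg)
  qed (simp add: path_gain_def mult.assoc)
  from this[OF coef_pos[of T]] this[OF coef_pos[of R]] show
    "interf (beta bT R * PB * Cr) \<alpha> dc (PhiT w) = enn2real (itot T w)"
    "interf (beta bT T * PB * Cr) \<alpha> dc (PhiR w) = enn2real (itot R w)"
    by (simp_all add: interf_def itot_def Phi_def coef_def)
qed

section \<open>Limits in n and x: almost sure finiteness and the coverage event\<close>

lemma prob_all_covered:
  assumes "x > 0"
  shows "measure M {w \<in> space M. \<forall>n. covered n c x w} = (\<integral>r. cov_integrand c x r \<partial>lborel)"
proof (rule LIMSEQ_unique)
  \<comment> \<open>Discretised loads increase with n, so the events shrink. Continuity from above
    gives one limit of their probabilities, dominated convergence of the integrands the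
    other.\<close>
  have "decseq (\<lambda>n. {w \<in> space M. covered n c x w})"
  proof (rule decseq_SucI, safe)
    fix n w assume w: "w \<in> space M" "covered (Suc n) c x w"
    have "disc_itot n md w \<le> disc_itot (Suc n) md w" for md
      using disc_itot_incseq[OF w(1)] by (simp add: incseq_Suc_iff)
    then have "load n c (r1 w) (counts n w) \<le> load (Suc n) c (r1 w) (counts (Suc n) w)"
      unfolding load_counts by (intro mult_left_mono add_mono sfac_nonneg) auto
    then have "thr * (x * load n c (r1 w) (counts n w)) \<le> thr * (x * load (Suc n) c (r1 w) (counts (Suc n) w))"
      using params assms by (intro mult_left_mono) auto
    then show "covered n c x w" using w by (auto simp: covered_def)
  qed
  then have "(\<lambda>n. measure M {w \<in> space M. covered n c x w}) \<longlonglongrightarrow> measure M (\<Inter>n. {w \<in> space M. covered n c x w})"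
    by (intro finite_Lim_measure_decseq) auto
  also have "(\<Inter>n. {w \<in> space M. covered n c x w}) = {w \<in> space M. \<forall>n. covered n c x w}" by auto
  finally show "(\<lambda>n. measure M {w \<in> space M. covered n c x w}) \<longlonglongrightarrow> measure M {w \<in> space M. \<forall>n. covered n c x w}" .
  have "(\<lambda>n. \<integral>r. disc_integrand n c x r \<partial>lborel) \<longlonglongrightarrow> (\<integral>r. cov_integrand c x r \<partial>lborel)"
    by (rule integral_dominated_convergence[OF _ _ integrable_half_density])
       (use assms cov_integrand_measurable disc_integrand_measurable disc_integrand_bounds disc_integrand_tendsto
         in auto)
  then show "(\<lambda>n. measure M {w \<in> space M. covered n c x w}) \<longlonglongrightarrow> (\<integral>r. cov_integrand c x r \<partial>lborel)"
    using assms by (simp add: prob_covered)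
qed

lemma bell_tail_tendsto_1:
  assumes "r > 0"
  shows "(\<lambda>n. bell_tail k (log_laplace gain c r) (1 / real (Suc n))) \<longlonglongrightarrow> 1"
proof (rule real_tendsto_sandwich)
  let ?I = "\<lambda>md. \<integral>p. sfac c r * coef md * gain p \<partial>mark_intensity lam thI r"
  \<comment> \<open>The mean load given \<open>r1 = r\<close>. As 1 - exp (- v) <= v, the
    log-Laplace transform is at least \<open>- K * x\<close>, and the Bell tail dominates the
    transform.\<close>
  define K where "K = sfac c r * n0\<^sup>2 + ?I T + ?I R"
  have "- K * x \<le> log_laplace gain c r 0 x" if "x > 0" for x
  proof -
    have "(\<integral>p. 1 - exp (- x * (sfac c r * coef md * gain p)) \<partial>mark_intensity lam thI r) \<le> x * ?I md" for md
    proof -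
      have int: "integrable (mark_intensity lam thI r) (\<lambda>p. sfac c r * coef md * gain p)"
        using integrable_gain[OF assms] by simp
      have nn: "sfac c r * coef md * gain p \<ge> 0" for p
        using sfac_nonneg[of c r] coef_pos[of md] path_gain_nonneg[of \<alpha> dc p] by simp
      have "(\<integral>p. 1 - exp (- x * (sfac c r * coef md * gain p)) \<partial>mark_intensity lam thI r) \<le>
          (\<integral>p. x * (sfac c r * coef md * gain p) \<partial>mark_intensity lam thI r)"
      proof (rule integral_mono)
        show "integrable (mark_intensity lam thI r) (\<lambda>p. 1 - exp (- x * (sfac c r * coef md * gain p)))"
          using that by (intro integrable_one_minus_exp int nn) auto
        show "1 - exp (- x * (sfac c r * coef md * gain p)) \<le> x * (sfac c r * coef md * gain p)" for p
          using exp_ge_add_one_self[of "- x * (sfac c r * coef md * gain p)"] by simp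
      qed (use int in simp)
      then show ?thesis by simp
    qed
    from this[of T] this[of R] show ?thesis
      unfolding log_laplace_def laplace_exponent_def K_def by (simp add: algebra_simps)
  qed
  then show "\<forall>\<^sub>F n in sequentially. exp (- K * (1 / real (Suc n))) \<le> bell_tail k (log_laplace gain c r) (1 / real (Suc n))"
    using bell_tail_gain_bounds(1)[OF assms, of "1 / real (Suc n)" c for n]
    by (intro always_eventually allI) (meson exp_le_cancel_iff order_trans zero_less_divide_1_iff of_nat_0_less_iff zero_less_Suc)
  have "(\<lambda>n. exp (- K * inverse (real (Suc n)))) \<longlonglongrightarrow> exp (- K * 0)"
    by (intro tendsto_exp tendsto_mult tendsto_const LIMSEQ_inverse_real_of_nat)
  then show "(\<lambda>n. exp (- K * (1 / real (Suc n)))) \<longlonglongrightarrow> 1" by (simp add: inverse_eq_divide)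
qed (use bell_tail_gain_bounds(2)[OF assms] in auto)

lemma AE_r1_pos: "AE w in M. r1 w > 0"
proof -
  have "prob {w \<in> space M. r1 w \<in> {0<..}} = 1"
    using prob_split_chi[of "\<lambda>w. r1 w \<in> {0<..}"] prob_chi_r1_pos[of T] prob_chi_r1_pos[of R] by simp
  then have "AE w in M. w \<in> {w \<in> space M. r1 w \<in> {0<..}}"
    by (rule AE_prob_1)
  then show ?thesis by eventually_elim simp
qed

text \<open>As \<open>G w\<close> is a real number, any single x > 0, however small, bounds all
  discretised interferences and hence their limit \<open>itot\<close>.\<close>

lemma covered_imp_finite:
  assumes "w \<in> space M" "\<And>n. covered n c x w" "x > 0" "r1 w > 0"
  shows "G w > 0" "itot T w < \<infinity>" "itot R w < \<infinity>"
proof -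
  have pos: "thr * (x * sfac c (r1 w)) > 0"
    using params assms sfac_pos[of "r1 w" c] by simp
  have le: "disc_itot n T w \<le> G w / (thr * (x * sfac c (r1 w)))"
      "disc_itot n R w \<le> G w / (thr * (x * sfac c (r1 w)))" for n
  proof -
    have "(n0\<^sup>2 + disc_itot n T w + disc_itot n R w) * (thr * (x * sfac c (r1 w))) \<le> G w"
      using assms(2)[of n] by (simp add: covered_def load_counts mult_ac)
    then have "n0\<^sup>2 + disc_itot n T w + disc_itot n R w \<le> G w / (thr * (x * sfac c (r1 w)))"
      using pos by (simp only: pos_le_divide_eq)
    then show "disc_itot n T w \<le> G w / (thr * (x * sfac c (r1 w)))"
      "disc_itot n R w \<le> G w / (thr * (x * sfac c (r1 w)))"
      using disc_itot_nonneg[of n T w] disc_itot_nonneg[of n R w] zero_le_power2[of n0] by linarith+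
  qed
  then show "itot T w < \<infinity>" "itot R w < \<infinity>"
    using itot_finiteI[OF assms(1)] by blast+
  have "thr * (x * load 0 c (r1 w) (counts 0 w)) \<ge> 0"
    using params assms load_nonneg by simp
  then show "G w > 0" using assms(2)[of 0] by (simp add: covered_def)
qed

text \<open>Coverage at x = 1 / (n + 1) forces regularity up to the sign of \<open>r1\<close>, and
  in each mode its probability tends to 1/2. Both modes together exhaust the whole mass.\<close>

lemma AE_regular: "AE w in M. r1 w > 0 \<and> G w > 0 \<and> itot T w < \<infinity> \<and> itot R w < \<infinity>"
proof -
  \<comment> \<open>Bounding the interference by \<open>G\<close> divides by \<open>sfac\<close>,
    which needs a nonzero \<open>r1\<close>; that \<open>r1\<close> is positive almost surely is
    added at the end.\<close>
  define Q where "Q w \<longleftrightarrow> (r1 w > 0 \<longrightarrow> G w > 0 \<and> itot T w < \<infinity> \<and> itot R w < \<infinity>)" for w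
  have [measurable]: "Measurable.pred M Q" unfolding Q_def[abs_def] by measurable
  have "1 / 2 \<le> prob {w \<in> space M. Q w \<and> chi w = c}" for c
  proof (rule LIMSEQ_le_const2)
    have "(\<lambda>n. \<integral>r. cov_integrand c (1 / real (Suc n)) r \<partial>lborel) \<longlonglongrightarrow> (\<integral>r. r1_density lam r / 2 * 1 \<partial>lborel)"
      by (rule integral_cov_integrand_tendsto) (auto simp: bell_tail_tendsto_1 simp del: of_nat_Suc)
    then show "(\<lambda>n. \<integral>r. cov_integrand c (1 / real (Suc n)) r \<partial>lborel) \<longlonglongrightarrow> 1 / 2"
      using half_density by simp
    have "(\<integral>r. cov_integrand c (1 / real (Suc n)) r \<partial>lborel) \<le> prob {w \<in> space M. Q w \<and> chi w = c}" for n
    proof -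
      have "(\<integral>r. cov_integrand c (1 / real (Suc n)) r \<partial>lborel) =
        prob {w \<in> space M. \<forall>m. covered m c (1 / real (Suc n)) w}"
        by (rule prob_all_covered[symmetric]) simp
      also have "\<dots> \<le> prob {w \<in> space M. Q w \<and> chi w = c}"
      proof (rule finite_measure_mono)
        show "{w \<in> space M. \<forall>m. covered m c (1 / real (Suc n)) w} \<subseteq> {w \<in> space M. Q w \<and> chi w = c}"
          using covered_imp_finite[of _ c "1 / real (Suc n)"] by (auto simp: Q_def) (auto simp: covered_def)
      qed measurable
      finally show ?thesis .
    qed
    then show "\<exists>N. \<forall>n\<ge>N. (\<integral>r. cov_integrand c (1 / real (Suc n)) r \<partial>lborel) \<le> prob {w \<in> space M. Q w \<and> chi w = c}"
      by blast
  qed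
  from this[of T] this[of R] have "prob {w \<in> space M. Q w} \<ge> 1"
    by (subst prob_split_chi) auto
  then have "prob {w \<in> space M. Q w} = 1" using prob_le_1 by (intro antisym) auto
  then have "AE w in M. w \<in> {w \<in> space M. Q w}" by (rule AE_prob_1)
  with AE_r1_pos show ?thesis by eventually_elim (simp add: Q_def)
qed

text \<open>Finiteness is part of the event because \<open>enn2real\<close> maps infinity to
  0.\<close>

definition coverage_event :: "mode \<Rightarrow> 'w set" where
  "coverage_event c = {w \<in> space M. chi w = c \<and> r1 w > 0 \<and> itot T w < \<infinity> \<and> itot R w < \<infinity> \<and>
     G w > thr * (sfac c (r1 w) * (n0\<^sup>2 + enn2real (itot T w) + enn2real (itot R w)))}"

lemma coverage_event_sets [measurable]: "coverage_event c \<in> sets M"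
  unfolding coverage_event_def by measurable

lemma coverage_event_subset: "coverage_event c \<subseteq> {w \<in> space M. \<forall>n. covered n c 1 w}"
proof safe
  fix w n assume w: "w \<in> coverage_event c"
  then have "disc_itot n T w \<le> enn2real (itot T w)" "disc_itot n R w \<le> enn2real (itot R w)"
    by (auto simp: coverage_event_def intro!: disc_itot_finite)
  then have "thr * (sfac c (r1 w) * (n0\<^sup>2 + disc_itot n T w + disc_itot n R w)) \<le>
      thr * (sfac c (r1 w) * (n0\<^sup>2 + enn2real (itot T w) + enn2real (itot R w)))"
    using params by (intro mult_left_mono add_mono sfac_nonneg) auto
  then show "covered n c 1 w"
    using w by (auto simp: covered_def load_counts coverage_event_def)
qed (auto simp: coverage_event_def)

text \<open>The limit in n loses strictness and only gives x times the threshold <=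
  \<open>G\<close>. A positive threshold recovers it from x > 1, a zero threshold from
  \<open>G w > 0\<close>.\<close>

lemma coverage_event_superset:
  assumes "x > 1" "w \<in> space M" "\<And>n. covered n c x w" "r1 w > 0"
  shows "w \<in> coverage_event c"
proof -
  note fin = covered_imp_finite[OF assms(2,3) _ assms(4)]
  define t where "t = n0\<^sup>2 + enn2real (itot T w) + enn2real (itot R w)"
  have "t \<ge> 0" by (simp add: t_def)
  have s: "sfac c (r1 w) > 0" using assms sfac_pos by simp
  have "G w > thr * (sfac c (r1 w) * t)"
  proof (cases "t = 0")
    case True
    then show ?thesis using fin(1) assms by simp
  next
    case False
    have "(\<lambda>n. thr * (x * (sfac c (r1 w) * (n0\<^sup>2 + disc_itot n T w + disc_itot n R w)))) \<longlonglongrightarrow>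
        thr * (x * (sfac c (r1 w) * t))"
      unfolding t_def using fin(2,3) assms by (intro tendsto_intros disc_itot_finite) auto
    then have le: "thr * (x * (sfac c (r1 w) * t)) \<le> G w"
      by (rule LIMSEQ_le_const2) (use assms(3) in \<open>auto simp: covered_def load_counts less_imp_le\<close>)
    have "thr * (sfac c (r1 w) * t) * 1 < thr * (sfac c (r1 w) * t) * x"
      using False \<open>t \<ge> 0\<close> s params assms by (intro mult_strict_left_mono) auto
    then show ?thesis using le by (simp add: mult_ac)
  qed
  then show ?thesis
    using fin assms assms(3)[of 0] by (auto simp: coverage_event_def t_def covered_def)
qed

text \<open>The event lies inside the all-covered event at x = 1 and, almost surely, contains the
  one at any x > 1; continuity of the integrand in x makes the two bounds meet.\<close>

lemma prob_coverage_event: "prob (coverage_event c) = (\<integral>r. cov_integrand c 1 r \<partial>lborel)"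
proof (rule antisym)
  show "prob (coverage_event c) \<le> (\<integral>r. cov_integrand c 1 r \<partial>lborel)"
    using finite_measure_mono[OF coverage_event_subset] by (simp add: prob_all_covered)
  show "(\<integral>r. cov_integrand c 1 r \<partial>lborel) \<le> prob (coverage_event c)"
  proof (rule LIMSEQ_le_const2)
    have cont: "(\<lambda>n. bell_tail k (log_laplace gain c r) (1 + 1 / real (Suc n))) \<longlonglongrightarrow>
        bell_tail k (log_laplace gain c r) 1" if "r > 0" for r
    proof -
      have X: "(\<lambda>n. 1 + 1 / real (Suc n)) \<longlonglongrightarrow> 1"
        using tendsto_add[OF tendsto_const[of 1] LIMSEQ_inverse_real_of_nat] by (simp add: inverse_eq_divide)
      have "(\<lambda>n. log_laplace gain c r j (1 + 1 / real (Suc n))) \<longlonglongrightarrow> log_laplace gain c r j 1" for j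
      proof (rule isCont_tendsto_compose[OF _ X])
        show "isCont (log_laplace gain c r j) 1"
          using that by (intro DERIV_isCont[OF log_laplace_has_derivative] integrable_gain path_gain_nonneg) auto
      qed
      then show ?thesis unfolding bell_tail_def
        by (intro tendsto_intros bell_tendsto X) auto
    qed
    show "(\<lambda>n. \<integral>r. cov_integrand c (1 + 1 / real (Suc n)) r \<partial>lborel) \<longlonglongrightarrow> (\<integral>r. cov_integrand c 1 r \<partial>lborel)"
      unfolding cov_integrand_def[of c 1]
      by (rule integral_cov_integrand_tendsto)
         (use cont cov_integrand_measurable[of 1 c] in \<open>auto simp: cov_integrand_def[abs_def] add_pos_nonneg\<close>)
    have "(\<integral>r. cov_integrand c x r \<partial>lborel) \<le> prob (coverage_event c)" if "x > 1" for x
    proof -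
      have "(\<integral>r. cov_integrand c x r \<partial>lborel) = prob {w \<in> space M. \<forall>m. covered m c x w}"
        using that by (intro prob_all_covered[symmetric]) simp
      also have "\<dots> \<le> prob (coverage_event c)"
      proof (rule finite_measure_mono_AE)
        show "AE w in M. w \<in> {w \<in> space M. \<forall>m. covered m c x w} \<longrightarrow> w \<in> coverage_event c"
          using AE_r1_pos by eventually_elim (use coverage_event_superset that in auto)
      qed simp
      finally show ?thesis .
    qed
    then show "\<exists>N. \<forall>n\<ge>N. (\<integral>r. cov_integrand c (1 + 1 / real (Suc n)) r \<partial>lborel) \<le> prob (coverage_event c)"
      by (intro exI[of _ 0] allI impI) simp
  qed
qed

text \<open>\<open>G w > 0\<close> makes S and with it the denominator positive, even when noise and
  interference vanish; \<open>cond\<close> makes the division by \<open>aC - aT * tau\<close>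
  preserve the inequality.\<close>

lemma coverage_iff:
  assumes "w \<in> space M" "r1 w > 0" "G w > 0" "itot T w < \<infinity>" "itot R w < \<infinity>"
  shows "(let S = beta bT (chi w) * PB * Cr * (r1 w * dc) powr (- \<alpha>) * G w;
              I = interf (beta bT R * PB * Cr) \<alpha> dc (PhiT w) + interf (beta bT T * PB * Cr) \<alpha> dc (PhiR w)
          in aC * S / (aT * S + I + n0\<^sup>2)) > tau \<longleftrightarrow> w \<in> coverage_event (chi w)"
proof -
  define b where "b = beta bT (chi w) * PB * Cr"
  define a where "a = (r1 w * dc) powr \<alpha>"
  define I where "I = enn2real (itot T w) + enn2real (itot R w)"
  define S where "S = b * (r1 w * dc) powr (- \<alpha>) * G w"
  have b: "b > 0" using params beta_pos[of bT "chi w"] by (simp add: b_def)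
  have a: "a > 0" using params assms by (simp add: a_def)
  have S: "S = b * G w / a" by (simp add: S_def a_def powr_minus_divide)
  have "S > 0" using a b assms by (simp add: S)
  have I: "I \<ge> 0" by (simp add: I_def)
  have d: "aC - aT * tau > 0" using cond by simp
  have "aT * S + I + n0\<^sup>2 > 0"
    using \<open>S > 0\<close> params I by (intro add_pos_nonneg) auto
  then have "aC * S / (aT * S + I + n0\<^sup>2) > tau \<longleftrightarrow> tau * (aT * S + I + n0\<^sup>2) < aC * S"
    by (simp add: pos_less_divide_eq)
  also have "\<dots> \<longleftrightarrow> tau * (n0\<^sup>2 + I) < S * (aC - aT * tau)"
    by (simp add: algebra_simps)
  also have "\<dots> \<longleftrightarrow> tauS * (n0\<^sup>2 + I) < S"
    using d by (simp add: tauS_def pos_divide_less_eq)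
  also have "\<dots> \<longleftrightarrow> tauS * (n0\<^sup>2 + I) * (a / b) < G w"
    using a b by (simp add: S field_simps)
  also have "tauS * (n0\<^sup>2 + I) * (a / b) = thr * (sfac (chi w) (r1 w) * (n0\<^sup>2 + I))"
  proof -
    have "sfac (chi w) (r1 w) = tauS * a / (thr * b)" by (simp add: sfac_def a_def b_def mult.assoc)
    then show ?thesis using params by simp
  qed
  finally show ?thesis
    using assms by (simp add: interf_eq coverage_event_def Let_def S_def b_def I_def add.assoc)
qed

lemma prob_coverage:
  "prob {w \<in> space M. (let S = beta bT (chi w) * PB * Cr * (r1 w * dc) powr (- \<alpha>) * G w;
              I = interf (beta bT R * PB * Cr) \<alpha> dc (PhiT w) + interf (beta bT T * PB * Cr) \<alpha> dc (PhiR w)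
          in aC * S / (aT * S + I + n0\<^sup>2)) > tau} =
   (\<Sum>c\<in>{T, R}. \<integral>r. cov_integrand c 1 r \<partial>lborel)" (is "prob ?E = _")
proof -
  have [measurable]: "beta bT \<in> borel_measurable (count_space UNIV)" by simp
  have "prob ?E = prob (coverage_event T \<union> coverage_event R)"
  proof (rule finite_measure_eq_AE)
    show "?E \<in> sets M" unfolding interf_eq Let_def by measurable
    show "AE w in M. w \<in> ?E \<longleftrightarrow> w \<in> coverage_event T \<union> coverage_event R"
      using AE_regular AE_space
    proof eventually_elim
      case (elim w)
      have "w \<in> coverage_event (chi w) \<longleftrightarrow> w \<in> coverage_event T \<union> coverage_event R"
        by (cases "chi w") (auto simp: coverage_event_def)
      then show ?case using elim coverage_iff[of w] by simp
    qed
  qed measurable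
  also have "\<dots> = prob (coverage_event T) + prob (coverage_event R)"
    by (rule finite_measure_Union) (auto simp: coverage_event_def[of T] coverage_event_def[of R])
  finally show ?thesis by (simp add: prob_coverage_event)
qed

section \<open>Identification with the closed form\<close>

lemma Lam_eq_log_laplace:
  assumes "r > 0" "x > 0"
  shows "Lam lam PB Cr thr thI \<alpha> dc n0 bT (tau / (aC - aT * tau)) r c x =
         log_laplace gain c r 0 x - pi * lam * r\<^sup>2"
proof -
  define D where "D psi = thI * tauS * beta bT psi / (thr * beta bT c)" for psi
  have arg: "x * (sfac c r * coef md) * thI * (r * dc) powr (- \<alpha>) = D (case md of T \<Rightarrow> R | R \<Rightarrow> T) * x" for md
  proof -
    \<comment> \<open>The path loss at the edge of the excluded ball cancels the one of the serving
      signal in \<open>sfac\<close>, so D is free of r.\<close>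
    have "(r * dc) powr \<alpha> * (r * dc) powr (- \<alpha>) = 1"
      using params assms by (simp add: powr_add[symmetric])
    moreover have "x * (sfac c r * coef md) * thI * (r * dc) powr (- \<alpha>) =
        D (case md of T \<Rightarrow> R | R \<Rightarrow> T) * x * ((r * dc) powr \<alpha> * (r * dc) powr (- \<alpha>))"
      using params beta_pos[of bT c]
      by (cases md) (simp_all add: sfac_def coef_def D_def field_simps)
    ultimately show ?thesis by simp
  qed
  have "(\<integral>p. 1 - exp (- x * (sfac c r * coef md * gain p)) \<partial>mark_intensity lam thI r) =
      1 / 2 * pi * lam * r\<^sup>2 * (hypF \<alpha> (D (case md of T \<Rightarrow> R | R \<Rightarrow> T) * x) - 1)" for md
    unfolding arg[symmetric] using params assms sfac_nonneg[of c r] coef_pos[of md]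
    by (intro laplace_exponent_path_gain[where q="sfac c r * coef md", folded mult.assoc[of x]]) auto
  note this[of T] this[of R]
  then have "log_laplace gain c r 0 x = - sfac c r * n0\<^sup>2 * x
      - 1 / 2 * pi * lam * r\<^sup>2 * (hypF \<alpha> (D R * x) - 1) - 1 / 2 * pi * lam * r\<^sup>2 * (hypF \<alpha> (D T * x) - 1)"
    by (simp add: log_laplace_def laplace_exponent_def)
  \<comment> \<open>The two terms -1 next to \<open>hypF\<close> each leave
    \<open>1/2 * pi * lam * r^2\<close>, together the difference from \<open>Lam\<close>.\<close>
  then show ?thesis
    by (simp add: Lam_def Let_def sfac_def D_def tauS_def[symmetric] algebra_simps)
qed

lemma cov_integrand_eq:
  assumes "r > 0"
  shows "cov_integrand c 1 r = pi * lam * r * (\<Sum>m<k. (-1) ^ m / fact m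
              * exp (Lam lam PB Cr thr thI \<alpha> dc n0 bT (tau / (aC - aT * tau)) r c 1)
              * bell m (\<lambda>j. (deriv ^^ j) (Lam lam PB Cr thr thI \<alpha> dc n0 bT (tau / (aC - aT * tau)) r c) 1))"
proof -
  let ?L = "Lam lam PB Cr thr thI \<alpha> dc n0 bT (tau / (aC - aT * tau)) r c"
  \<comment> \<open>The shift affects order 0 only, so it enters the exponential factor but no Bell
    polynomial.\<close>
  define f where "f j x = log_laplace gain c r j x - (if j = 0 then pi * lam * r\<^sup>2 else 0)" for j x
  have f: "(f j has_real_derivative f (Suc j) x) (at x)" if "x > 0" for j x
    unfolding f_def[abs_def] using that assms
    by (auto intro!: derivative_eq_intros log_laplace_has_derivative integrable_gain path_gain_nonneg)
  have "(deriv ^^ j) ?L 1 = f j 1" for j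
    by (rule funpow_deriv_eq[where f=f]) (use assms f in \<open>auto simp: f_def Lam_eq_log_laplace\<close>)
  then have bell: "bell m (\<lambda>j. (deriv ^^ j) ?L 1) = bell m (\<lambda>j. log_laplace gain c r j 1)" for m
    by (intro bell_cong) (simp add: f_def)
  \<comment> \<open>The 1/2 of the mode reduces \<open>2 * pi\<close> to \<open>pi\<close>, and the
    Gaussian factor of the density is the shift between the log-Laplace transform and
    \<open>Lam\<close>.\<close>
  have dens: "r1_density lam r / 2 * exp (log_laplace gain c r 0 1) = pi * lam * r * exp (?L 1)"
    using assms by (simp add: r1_density_def Lam_eq_log_laplace exp_diff exp_minus field_simps)
  have "r1_density lam r / 2 * ((-1) ^ m / fact m * (exp (log_laplace gain c r 0 1) * b)) =
      pi * lam * r * ((-1) ^ m / fact m * exp (?L 1) * b)" for m b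
  proof -
    have "r1_density lam r / 2 * ((-1) ^ m / fact m * (exp (log_laplace gain c r 0 1) * b)) =
        r1_density lam r / 2 * exp (log_laplace gain c r 0 1) * ((-1) ^ m / fact m * b)"
      by (simp only: mult_ac)
    then show ?thesis by (simp only: dens mult_ac)
  qed
  then show ?thesis
    unfolding cov_integrand_def bell_tail_def sum_distrib_left bell by simp
qed

text \<open>Passes from the Bochner integral over the line to the Henstock-Kurzweil integral of the
  theorem; the density vanishes for r <= 0, and absolute integrability makes the two notions
  agree.\<close>

lemma integral_cov_integrand:
  "(\<integral>r. cov_integrand c 1 r \<partial>lborel) = integral {0<..} (\<lambda>r. pi * lam * r * (\<Sum>m<k. (-1) ^ m / fact m
              * exp (Lam lam PB Cr thr thI \<alpha> dc n0 bT (tau / (aC - aT * tau)) r c 1)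
              * bell m (\<lambda>j. (deriv ^^ j) (Lam lam PB Cr thr thI \<alpha> dc n0 bT (tau / (aC - aT * tau)) r c) 1)))"
proof -
  have set: "set_integrable lborel {0<..} (cov_integrand c 1)"
    unfolding set_integrable_def using integrable_cov_integrand[of 1 c] by (intro integrable_mult_indicator) auto
  have "(\<integral>r. cov_integrand c 1 r \<partial>lborel) = (LINT r:{0<..}|lborel. cov_integrand c 1 r)"
    unfolding set_lebesgue_integral_def
    by (intro Bochner_Integration.integral_cong) (auto simp: cov_integrand_def r1_density_def split: split_indicator)
  also have "\<dots> = integral {0<..} (cov_integrand c 1)"
    by (rule set_borel_integral_eq_integral(2)[OF set])
  also have "\<dots> = integral {0<..} (\<lambda>r. pi * lam * r * (\<Sum>m<k. (-1) ^ m / fact m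
              * exp (Lam lam PB Cr thr thI \<alpha> dc n0 bT (tau / (aC - aT * tau)) r c 1)
              * bell m (\<lambda>j. (deriv ^^ j) (Lam lam PB Cr thr thI \<alpha> dc n0 bT (tau / (aC - aT * tau)) r c) 1)))"
    by (rule Henstock_Kurzweil_Integration.integral_cong) (simp only: greaterThan_iff cov_integrand_eq)
  finally show ?thesis .
qed

end

theorem theorem2:
  fixes M :: "'w measure"
    and lam PB Cr thr thI dc n0 \<alpha> bT aT aC tau :: real
    and k :: nat
    and r1 G :: "'w \<Rightarrow> real"
    and chi :: "'w \<Rightarrow> mode"
    and PhiT PhiR :: "'w \<Rightarrow> ((real \<times> real) \<times> real) set"
  assumes params: "lam > 0" "PB > 0" "Cr > 0" "thr > 0" "thI > 0" "dc > 0" "\<alpha> > 2" "k \<ge> 1"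
      "0 < bT" "bT < 1" "0 < aT" "aT < aC" "aT + aC = 1" "tau > 0"
    and cond: "aC > aT * tau"
    and M: "prob_space M"
    and meas: "r1 \<in> borel_measurable M" "G \<in> borel_measurable M"
      "chi \<in> measurable M (count_space UNIV)"
      "\<And>A. A \<in> sets borel \<Longrightarrow> bounded (fst ` A) \<Longrightarrow>
          (\<lambda>w. card (PhiT w \<inter> A)) \<in> measurable M (count_space UNIV)"
      "\<And>A. A \<in> sets borel \<Longrightarrow> bounded (fst ` A) \<Longrightarrow>
          (\<lambda>w. card (PhiR w \<inter> A)) \<in> measurable M (count_space UNIV)"
    and locfin: "\<And>w A. w \<in> space M \<Longrightarrow> bounded (fst ` A) \<Longrightarrow> finite (PhiT w \<inter> A)"
      "\<And>w A. w \<in> space M \<Longrightarrow> bounded (fst ` A) \<Longrightarrow> finite (PhiR w \<inter> A)"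
    and law: "\<And>B c C (As :: nat \<Rightarrow> ((real \<times> real) \<times> real) set) n ns
                      (As' :: nat \<Rightarrow> ((real \<times> real) \<times> real) set) m ms.
      B \<in> sets borel \<Longrightarrow> C \<in> sets borel \<Longrightarrow>
      disjoint_family_on As {..<n} \<Longrightarrow> (\<forall>i<n. As i \<in> sets borel \<and> bounded (fst ` As i)) \<Longrightarrow>
      disjoint_family_on As' {..<m} \<Longrightarrow> (\<forall>j<m. As' j \<in> sets borel \<and> bounded (fst ` As' j)) \<Longrightarrow>
      measure M {w \<in> space M. r1 w \<in> B \<and> chi w = c \<and> G w \<in> C
          \<and> (\<forall>i<n. card (PhiT w \<inter> As i) = ns i) \<and> (\<forall>j<m. card (PhiR w \<inter> As' j) = ms j)}
      = (\<integral>r. indicator B r * r1_density lam r * (1 / 2) * measure (gamma_measure k thr) C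
            * (\<Prod>i<n. poisson_prob (measure (mark_intensity lam thI r) (As i)) (ns i))
            * (\<Prod>j<m. poisson_prob (measure (mark_intensity lam thI r) (As' j)) (ms j)) \<partial>lborel)"
  shows "measure M {w \<in> space M.
           (let S = beta bT (chi w) * PB * Cr * (r1 w * dc) powr (- \<alpha>) * G w;
                I = interf (beta bT R * PB * Cr) \<alpha> dc (PhiT w) + interf (beta bT T * PB * Cr) \<alpha> dc (PhiR w)
            in aC * S / (aT * S + I + n0\<^sup>2)) > tau}
       = (\<Sum>c\<in>{T, R}. integral {0<..} (\<lambda>r.
            pi * lam * r * (\<Sum>m<k. (-1) ^ m / fact m
              * exp (Lam lam PB Cr thr thI \<alpha> dc n0 bT (tau / (aC - aT * tau)) r c 1)
              * bell m (\<lambda>j. (deriv ^^ j) (Lam lam PB Cr thr thI \<alpha> dc n0 bT (tau / (aC - aT * tau)) r c) 1))))"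
proof -
  interpret star_ris M lam PB Cr thr thI dc n0 \<alpha> bT aT aC tau k r1 G chi PhiT PhiR
    by (rule star_ris.intro[OF M], rule star_ris_axioms.intro)
       (rule params cond meas locfin law; assumption)+
  show ?thesis
    unfolding prob_coverage integral_cov_integrand ..
qed

end
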